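(* In dimension $2$ there exist imaginary generalized Killing $\mathrm{Spin}^c$ spinors of type II with non-constant Killing function; that is, there exist a $2$-dimensional Riemannian $\mathrm{Spin}^c$ manifold $(M^2,g)$, a non-constant function $b\in C^\infty(M,\mathbb{R})$, and a spinor field $\psi\not\equiv0$ of type II on $M$ such that $\nabla_X\psi=\mathrm{i}b\,X\cdot\psi$ for all vector fields $X$ on $M$.
   Context: A Riemannian $\mathrm{Spin}^c$ manifold is an oriented Riemannian manifold $(M^n,g)$ without boundary equipped with a $\mathrm{Spin}^c$ structure with auxiliary Hermitian line bundle $L$ and a connection on the associated $\mathbb{S}^1$-principal bundle. $\Sigma M$ is the associated complex spinor bundle, with Clifford multiplication "$\cdot$" ($X\cdot X=-g(X,X)$), natural Hermitian product $\langle\cdot,\cdot\rangle$ (anti-linear in the second component, Clifford multiplication by tangent vectors skew-Hermitian), and $\mathrm{Spin}^c$ covariant derivative $\nabla$ induced by the Levi-Civita connection and the connection on $L$. Manifolds are taken connected here. For an imaginary generalized Killing spinor $\psi$ with Killing function $\mathrm{i}b$ put $f:=|\psi|^2$ and define the vector field $V$ by $g(V,X)=\mathrm{i}\langle X\cdot\psi,\psi\rangle$ for all $X$. The function $q_\psi:=f^2-\|V\|^2$ is a non-negative constant; $\psi$ is of type I if $q_\psi=0$ and of type II if $q_\psi>0$. *)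

theory Defs
  imports "HOL-Analysis.Analysis"
begin

section \<open>Smooth maps between open subsets of normed spaces\<close>

text \<open>Meant for open \<open>S\<close> in a Euclidean space: all iterated directional derivatives up to order
  \<open>k\<close> exist and are continuous.\<close>

primrec ck_on :: "nat \<Rightarrow> 'a::real_normed_vector set \<Rightarrow> ('a \<Rightarrow> 'b::real_normed_vector) \<Rightarrow> bool" where
  "ck_on 0 S f \<longleftrightarrow> continuous_on S f"
| "ck_on (Suc k) S f \<longleftrightarrow> (\<forall>x\<in>S. f differentiable (at x)) \<and>
     (\<forall>v. ck_on k S (\<lambda>x. frechet_derivative f (at x) v))"

definition smooth_on :: "'a::real_normed_vector set \<Rightarrow> ('a \<Rightarrow> 'b::real_normed_vector) \<Rightarrow> bool" where
  "smooth_on S f \<longleftrightarrow> (\<forall>k. ck_on k S f)"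


section \<open>Oriented Riemannian manifolds\<close>

text \<open>A chart is a pair of its domain and its coordinate map. A tangent vector at \<open>p\<close> is the family
  of its components in all charts around \<open>p\<close>, compatible under change of charts (and zero at
  the charts not containing \<open>p\<close>, so that equality of tangent vectors is equality of functions).\<close>

type_synonym ('p, 'n) chart = "'p set \<times> ('p \<Rightarrow> real ^ 'n)"
type_synonym ('p, 'n) tvec = "('p, 'n) chart \<Rightarrow> real ^ 'n"

record ('p, 'n) riem =
  space_of :: "'p topology"
  charts :: "('p, 'n::finite) chart set"
  metric :: "'p \<Rightarrow> ('p, 'n) tvec \<Rightarrow> ('p, 'n) tvec \<Rightarrow> real"

abbreviation points :: "('p, 'n::finite, 'z) riem_scheme \<Rightarrow> 'p set" where
  "points M \<equiv> topspace (space_of M)"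

definition cinv :: "('p, 'n::finite) chart \<Rightarrow> real ^ 'n \<Rightarrow> 'p" where
  "cinv c = inv_into (fst c) (snd c)"

definition transition :: "('p, 'n::finite) chart \<Rightarrow> ('p, 'n) chart \<Rightarrow> real ^ 'n \<Rightarrow> real ^ 'n" where
  "transition c d = snd d \<circ> cinv c"

text \<open>The last conjunct says that the atlas is oriented; it determines the orientation.\<close>

definition oriented_manifold :: "('p, 'n::finite, 'z) riem_scheme \<Rightarrow> bool" where
  "oriented_manifold M \<longleftrightarrow>
     Hausdorff_space (space_of M) \<and> second_countable (space_of M) \<and>
     points M = \<Union> (fst ` charts M) \<and>
     (\<forall>(U, \<phi>) \<in> charts M. openin (space_of M) U \<and> open (\<phi> ` U) \<and>
        homeomorphic_map (subtopology (space_of M) U) (top_of_set (\<phi> ` U)) \<phi>) \<and>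
     (\<forall>c\<in>charts M. \<forall>d\<in>charts M.
        smooth_on (snd c ` (fst c \<inter> fst d)) (transition c d) \<and>
        (\<forall>x \<in> snd c ` (fst c \<inter> fst d).
           det (matrix (frechet_derivative (transition c d) (at x))) > 0))"

definition smooth_map ::
  "('p, 'n::finite, 'z) riem_scheme \<Rightarrow> 'p set \<Rightarrow> ('p \<Rightarrow> 'b::real_normed_vector) \<Rightarrow> bool" where
  "smooth_map M U f \<longleftrightarrow> (\<forall>c\<in>charts M. smooth_on (snd c ` (U \<inter> fst c)) (f \<circ> cinv c))"

definition tangent_space :: "('p, 'n::finite, 'z) riem_scheme \<Rightarrow> 'p \<Rightarrow> ('p, 'n) tvec set" where
  "tangent_space M p = {X.
     (\<forall>c. \<not> (c \<in> charts M \<and> p \<in> fst c) \<longrightarrow> X c = 0) \<and>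
     (\<forall>c\<in>charts M. \<forall>d\<in>charts M. p \<in> fst c \<longrightarrow> p \<in> fst d \<longrightarrow>
        X d = frechet_derivative (transition c d) (at (snd c p)) (X c))}"

definition tlin :: "real \<Rightarrow> ('p, 'n::finite) tvec \<Rightarrow> real \<Rightarrow> ('p, 'n) tvec \<Rightarrow> ('p, 'n) tvec" where
  "tlin a X b Y = (\<lambda>c. a *\<^sub>R X c + b *\<^sub>R Y c)"

text \<open>The tangent vector at \<open>p\<close> with components \<open>w\<close> in the chart \<open>c\<close>.\<close>

definition tvec_of ::
  "('p, 'n::finite, 'z) riem_scheme \<Rightarrow> ('p, 'n) chart \<Rightarrow> 'p \<Rightarrow> real ^ 'n \<Rightarrow> ('p, 'n) tvec" where
  "tvec_of M c p w = (\<lambda>d. if d \<in> charts M \<and> p \<in> fst d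
     then frechet_derivative (transition c d) (at (snd c p)) w else 0)"

definition coord_vec ::
  "('p, 'n::finite, 'z) riem_scheme \<Rightarrow> ('p, 'n) chart \<Rightarrow> 'n \<Rightarrow> 'p \<Rightarrow> ('p, 'n) tvec" where
  "coord_vec M c i p = tvec_of M c p (axis i 1)"

definition smooth_vector_field ::
  "('p, 'n::finite, 'z) riem_scheme \<Rightarrow> 'p set \<Rightarrow> ('p \<Rightarrow> ('p, 'n) tvec) \<Rightarrow> bool" where
  "smooth_vector_field M U X \<longleftrightarrow> (\<forall>p\<in>U. X p \<in> tangent_space M p) \<and>
     (\<forall>c\<in>charts M. smooth_on (snd c ` (U \<inter> fst c)) (\<lambda>x. X (cinv c x) c))"

definition metric_coeff ::
  "('p, 'n::finite, 'z) riem_scheme \<Rightarrow> ('p, 'n) chart \<Rightarrow> 'n \<Rightarrow> 'n \<Rightarrow> real ^ 'n \<Rightarrow> real" where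
  "metric_coeff M c i j x =
     metric M (cinv c x) (coord_vec M c i (cinv c x)) (coord_vec M c j (cinv c x))"

definition oriented_riemannian_manifold :: "('p, 'n::finite, 'z) riem_scheme \<Rightarrow> bool" where
  "oriented_riemannian_manifold M \<longleftrightarrow> oriented_manifold M \<and>
     (\<forall>p\<in>points M. \<forall>X\<in>tangent_space M p. \<forall>Y\<in>tangent_space M p.
        metric M p X Y = metric M p Y X \<and>
        (X \<noteq> (\<lambda>_. 0) \<longrightarrow> metric M p X X > 0) \<and>
        (\<forall>Z\<in>tangent_space M p. \<forall>a b.
           metric M p (tlin a X b Y) Z = a * metric M p X Z + b * metric M p Y Z)) \<and>
     (\<forall>c\<in>charts M. \<forall>i j. smooth_on (snd c ` fst c) (metric_coeff M c i j))"

definition chart_at :: "('p, 'n::finite, 'z) riem_scheme \<Rightarrow> 'p \<Rightarrow> ('p, 'n) chart" where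
  "chart_at M p = (SOME c. c \<in> charts M \<and> p \<in> fst c)"

text \<open>The derivative of a function smooth near \<open>p\<close> along a tangent vector at \<open>p\<close>; like the
  Levi-Civita derivative below, it does not depend on the chart chosen.\<close>

definition deriv_along :: "('p, 'n::finite, 'z) riem_scheme \<Rightarrow> 'p \<Rightarrow> ('p, 'n) tvec \<Rightarrow>
    ('p \<Rightarrow> 'b::real_normed_vector) \<Rightarrow> 'b" where
  "deriv_along M p X f =
     (let c = chart_at M p in frechet_derivative (f \<circ> cinv c) (at (snd c p)) (X c))"

definition pderiv_at :: "(real ^ 'n::finite \<Rightarrow> real) \<Rightarrow> 'n \<Rightarrow> real ^ 'n \<Rightarrow> real" where
  "pderiv_at f i x = frechet_derivative f (at x) (axis i 1)"

definition christoffel :: "('p, 'n::finite, 'z) riem_scheme \<Rightarrow> ('p, 'n) chart \<Rightarrow>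
    'n \<Rightarrow> 'n \<Rightarrow> 'n \<Rightarrow> real ^ 'n \<Rightarrow> real" where
  "christoffel M c k i j x = 1/2 * (\<Sum>l\<in>UNIV.
     matrix_inv (\<chi> a b. metric_coeff M c a b x) $ k $ l *
       (pderiv_at (metric_coeff M c j l) i x + pderiv_at (metric_coeff M c i l) j x
        - pderiv_at (metric_coeff M c i j) l x))"

definition levi_civita :: "('p, 'n::finite, 'z) riem_scheme \<Rightarrow> ('p, 'n) tvec \<Rightarrow>
    ('p \<Rightarrow> ('p, 'n) tvec) \<Rightarrow> 'p \<Rightarrow> ('p, 'n) tvec" where
  "levi_civita M X Y p = (let c = chart_at M p in
     tvec_of M c p (\<chi> k. deriv_along M p X (\<lambda>y. Y y c $ k) +
       (\<Sum>i\<in>UNIV. \<Sum>j\<in>UNIV. christoffel M c k i j (snd c p) * X c $ i * Y p c $ j)))"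

definition oriented_frame ::
  "('p, 'n::finite, 'z) riem_scheme \<Rightarrow> 'p \<Rightarrow> ('n \<Rightarrow> ('p, 'n) tvec) \<Rightarrow> bool" where
  "oriented_frame M p e \<longleftrightarrow>
     (\<forall>i. e i \<in> tangent_space M p) \<and>
     (\<forall>i j. metric M p (e i) (e j) = (if i = j then 1 else 0)) \<and>
     (\<forall>c\<in>charts M. p \<in> fst c \<longrightarrow> det (\<chi> i j. e j c $ i) > 0)"

text \<open>The right action of rotation matrices on frames.\<close>

definition frame_act :: "('n \<Rightarrow> ('p, 'n::finite) tvec) \<Rightarrow> real ^ 'n ^ 'n \<Rightarrow> 'n \<Rightarrow> ('p, 'n) tvec" where
  "frame_act e B = (\<lambda>j c. \<Sum>i\<in>UNIV. B $ i $ j *\<^sub>R e i c)"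


section \<open>The complex spin representation and the group Spin-c\<close>

definition cliff :: "('n::finite \<Rightarrow> complex ^ 's ^ 's) \<Rightarrow> real ^ 'n \<Rightarrow> complex ^ 's ^ 's::finite" where
  "cliff \<gamma> v = (\<Sum>i\<in>UNIV. v $ i *\<^sub>R \<gamma> i)"

text \<open>\<open>\<gamma>\<close> gives Clifford multiplication by the standard basis of \<open>\<real>\<^sup>n\<close> on an irreducible complex
  Clifford module with invariant standard Hermitian product: irreducibility is the dimension
  condition.\<close>

definition spin_module :: "('n::finite \<Rightarrow> complex ^ 's ^ 's::finite) \<Rightarrow> bool" where
  "spin_module \<gamma> \<longleftrightarrow> CARD('s) = 2 ^ (CARD('n) div 2) \<and>
     (\<forall>i j. \<gamma> i ** \<gamma> j + \<gamma> j ** \<gamma> i = mat (if i = j then -2 else 0)) \<and>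
     (\<forall>i a b. \<gamma> i $ a $ b = - cnj (\<gamma> i $ b $ a))"

text \<open>The spin representation is faithful on the even part of the complex Clifford algebra in every
  dimension, so the groups are realised by matrices on the spin module.\<close>

inductive_set spin_group :: "('n::finite \<Rightarrow> complex ^ 's ^ 's) \<Rightarrow> (complex ^ 's ^ 's::finite) set"
  for \<gamma> :: "'n::finite \<Rightarrow> complex ^ 's ^ 's::finite" where
  one: "mat 1 \<in> spin_group \<gamma>"
| step: "norm u = 1 \<Longrightarrow> norm v = 1 \<Longrightarrow> h \<in> spin_group \<gamma> \<Longrightarrow>
    cliff \<gamma> u ** cliff \<gamma> v ** h \<in> spin_group \<gamma>"

definition spinc_group ::
  "('n::finite \<Rightarrow> complex ^ 's ^ 's) \<Rightarrow> (complex ^ 's ^ 's::finite) set" where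
  "spinc_group \<gamma> = {mat z ** h | z h. cmod z = 1 \<and> h \<in> spin_group \<gamma>}"

text \<open>The two components of the double cover of \<open>SO(n) \<times> S\<^sup>1\<close>.\<close>

definition spinc_Ad ::
  "('n::finite \<Rightarrow> complex ^ 's ^ 's) \<Rightarrow> complex ^ 's ^ 's::finite \<Rightarrow> real ^ 'n ^ 'n" where
  "spinc_Ad \<gamma> h = (THE B. \<forall>v. cliff \<gamma> (B *v v) = h ** cliff \<gamma> v ** matrix_inv h)"

definition spinc_det ::
  "('n::finite \<Rightarrow> complex ^ 's ^ 's) \<Rightarrow> complex ^ 's ^ 's::finite \<Rightarrow> complex" where
  "spinc_det \<gamma> h = (THE w. \<exists>z a. cmod z = 1 \<and> a \<in> spin_group \<gamma> \<and> h = mat z ** a \<and> w = z\<^sup>2)"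


section \<open>Principal bundles\<close>

text \<open>Principal bundles with structure group \<open>G\<close> a closed subgroup of the units of a
  finite-dimensional algebra with product \<open>mlt\<close> and unit \<open>e\<close>. The smooth structure of the
  total space is given by a family of local sections \<open>s : U \<rightarrow> P\<close> with smooth transition functions,
  i.e. by the local trivialisations \<open>(x, h) \<mapsto> s(x) h\<close>. Local sections are represented by
  pairs of their domain and an arbitrary extension to a total function.\<close>

type_synonym ('p, 'q) lsec = "'p set \<times> ('p \<Rightarrow> 'q)"

record ('p, 'h, 'q) pbundle =
  total :: "'q set"
  proj :: "'q \<Rightarrow> 'p"
  act :: "'q \<Rightarrow> 'h \<Rightarrow> 'q"
  trivs :: "('p, 'q) lsec set"

definition smooth_sections :: "('p, 'n::finite, 'z) riem_scheme \<Rightarrow> 'h::real_normed_vector set \<Rightarrow>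
    ('p, 'h, 'q) pbundle \<Rightarrow> ('p, 'q) lsec set" where
  "smooth_sections M G P = {(U, t). openin (space_of M) U \<and>
     (\<forall>p\<in>U. t p \<in> total P \<and> proj P (t p) = p) \<and>
     (\<forall>(V, s)\<in>trivs P. \<exists>h. smooth_map M (U \<inter> V) h \<and>
        (\<forall>p\<in>U \<inter> V. h p \<in> G \<and> t p = act P (s p) (h p)))}"

definition principal_bundle :: "('p, 'n::finite, 'z) riem_scheme \<Rightarrow> 'h::real_normed_vector set \<Rightarrow>
    ('h \<Rightarrow> 'h \<Rightarrow> 'h) \<Rightarrow> 'h \<Rightarrow> ('p, 'h, 'q) pbundle \<Rightarrow> bool" where
  "principal_bundle M G mlt e P \<longleftrightarrow>
     proj P ` total P = points M \<and>
     (\<forall>q\<in>total P. act P q e = q \<and>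
        (\<forall>h\<in>G. act P q h \<in> total P \<and> proj P (act P q h) = proj P q \<and>
           (\<forall>k\<in>G. act P (act P q h) k = act P q (mlt h k))) \<and>
        (\<forall>q'\<in>total P. proj P q' = proj P q \<longrightarrow> (\<exists>!h. h \<in> G \<and> q' = act P q h))) \<and>
     \<Union> (fst ` trivs P) = points M \<and>
     trivs P \<subseteq> smooth_sections M G P"

abbreviation circle :: "complex set" where
  "circle \<equiv> {z. cmod z = 1}"


section \<open>Riemannian Spin-c manifolds\<close>

text \<open>\<open>circle_bundle\<close> is the circle bundle of the auxiliary line bundle, \<open>cover\<close> the
  equivariant bundle map from the Spin-c bundle to the fibre product of the oriented orthonormal
  frame bundle and the circle bundle. \<open>connection\<close> assigns to each smooth local section \<open>t\<close> of
  the circle bundle the pull-back along \<open>t\<close> of the imaginary valued connection form.\<close>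

record ('p, 'n, 's, 'q, 'r) spinc = "('p, 'n::finite) riem" +
  gam :: "'n \<Rightarrow> complex ^ 's ^ 's::finite"
  spinc_bundle :: "('p, complex ^ 's ^ 's, 'q) pbundle"
  circle_bundle :: "('p, complex, 'r) pbundle"
  cover :: "'q \<Rightarrow> ('n \<Rightarrow> ('p, 'n) tvec) \<times> 'r"
  connection :: "('p, 'r) lsec \<Rightarrow> 'p \<Rightarrow> ('p, 'n) tvec \<Rightarrow> complex"

abbreviation frame_at ::
  "('p, 'n::finite, 's::finite, 'q, 'r) spinc \<Rightarrow> 'q \<Rightarrow> 'n \<Rightarrow> ('p, 'n) tvec" where
  "frame_at M q \<equiv> fst (cover M q)"

definition spinc_structure :: "('p, 'n::finite, 's::finite, 'q, 'r) spinc \<Rightarrow> bool" where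
  "spinc_structure M \<longleftrightarrow>
     spin_module (gam M) \<and>
     principal_bundle M (spinc_group (gam M)) (**) (mat 1) (spinc_bundle M) \<and>
     principal_bundle M circle (*) 1 (circle_bundle M) \<and>
     (\<forall>q\<in>total (spinc_bundle M).
        oriented_frame M (proj (spinc_bundle M) q) (frame_at M q) \<and>
        snd (cover M q) \<in> total (circle_bundle M) \<and>
        proj (circle_bundle M) (snd (cover M q)) = proj (spinc_bundle M) q \<and>
        (\<forall>h\<in>spinc_group (gam M). cover M (act (spinc_bundle M) q h) =
           (frame_act (frame_at M q) (spinc_Ad (gam M) h),
            act (circle_bundle M) (snd (cover M q)) (spinc_det (gam M) h)))) \<and>
     (\<forall>(U, s)\<in>trivs (spinc_bundle M).
        (\<forall>i. smooth_vector_field M U (\<lambda>p. frame_at M (s p) i)) \<and>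
        (U, \<lambda>p. snd (cover M (s p))) \<in> smooth_sections M circle (circle_bundle M))"

definition circle_connection :: "('p, 'n::finite, 's::finite, 'q, 'r) spinc \<Rightarrow> bool" where
  "circle_connection M \<longleftrightarrow>
     (\<forall>(U, t)\<in>smooth_sections M circle (circle_bundle M).
        (\<forall>p\<in>U. \<forall>X\<in>tangent_space M p. Re (connection M (U, t) p X) = 0 \<and>
           (\<forall>Y\<in>tangent_space M p. \<forall>a b. connection M (U, t) p (tlin a X b Y) =
              of_real a * connection M (U, t) p X + of_real b * connection M (U, t) p Y)) \<and>
        (\<forall>c\<in>charts M. \<forall>i. smooth_on (snd c ` (U \<inter> fst c))
           (\<lambda>x. connection M (U, t) (cinv c x) (coord_vec M c i (cinv c x)))) \<and>
        (\<forall>(V, t')\<in>smooth_sections M circle (circle_bundle M). \<forall>h.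
           smooth_map M (U \<inter> V) h \<longrightarrow>
           (\<forall>p\<in>U \<inter> V. h p \<in> circle \<and> t' p = act (circle_bundle M) (t p) (h p)) \<longrightarrow>
           (\<forall>p\<in>U \<inter> V. \<forall>X\<in>tangent_space M p.
              connection M (V, t') p X =
              connection M (U, t) p X + inverse (h p) * deriv_along M p X h)))"

definition riemannian_spinc_manifold :: "('p, 'n::finite, 's::finite, 'q, 'r) spinc \<Rightarrow> bool" where
  "riemannian_spinc_manifold M \<longleftrightarrow>
     oriented_riemannian_manifold M \<and> connected_space (space_of M) \<and>
     spinc_structure M \<and> circle_connection M"


section \<open>Spinor fields\<close>

text \<open>The spinor bundle is the bundle associated with the Spin-c bundle and the spin module: its
  elements are the classes \<open>[q, v]\<close> with \<open>[q h, w] = [q, h w]\<close>.\<close>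

type_synonym ('q, 's) spinor = "('q \<times> (complex ^ 's)) set"

definition spinor_class ::
  "('p, 'n::finite, 's::finite, 'q, 'r) spinc \<Rightarrow> 'q \<Rightarrow> complex ^ 's \<Rightarrow> ('q, 's) spinor" where
  "spinor_class M q v =
     {(act (spinc_bundle M) q h, w) | h w. h \<in> spinc_group (gam M) \<and> h *v w = v}"

definition spinor_fibre ::
  "('p, 'n::finite, 's::finite, 'q, 'r) spinc \<Rightarrow> 'p \<Rightarrow> ('q, 's) spinor set" where
  "spinor_fibre M p =
     {spinor_class M q v | q v. q \<in> total (spinc_bundle M) \<and> proj (spinc_bundle M) q = p}"

text \<open>The components of a spinor with respect to a point of the Spin-c bundle.\<close>

definition spinor_comp :: "('q, 's::finite) spinor \<Rightarrow> 'q \<Rightarrow> complex ^ 's" where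
  "spinor_comp \<Psi> q = (THE v. (q, v) \<in> \<Psi>)"

definition zero_spinor :: "('p, 'n::finite, 's::finite, 'q, 'r) spinc \<Rightarrow> 'p \<Rightarrow> ('q, 's) spinor" where
  "zero_spinor M p = {(q, 0) | q. q \<in> total (spinc_bundle M) \<and> proj (spinc_bundle M) q = p}"

definition spinor_scale :: "complex \<Rightarrow> ('q, 's::finite) spinor \<Rightarrow> ('q, 's) spinor" where
  "spinor_scale z \<Psi> = {(q, z *s v) | q v. (q, v) \<in> \<Psi>}"

text \<open>Clifford multiplication by a tangent vector, via its components in the frame under \<open>q\<close>.\<close>

definition cliff_mult :: "('p, 'n::finite, 's::finite, 'q, 'r) spinc \<Rightarrow> ('p, 'n) tvec \<Rightarrow>
    ('q, 's) spinor \<Rightarrow> ('q, 's) spinor" where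
  "cliff_mult M X \<Psi> =
     {(q, cliff (gam M) (\<chi> i. metric M (proj (spinc_bundle M) q) X (frame_at M q i)) *v v)
      | q v. (q, v) \<in> \<Psi>}"

definition hprod :: "('q, 's::finite) spinor \<Rightarrow> ('q, 's) spinor \<Rightarrow> complex" where
  "hprod \<Psi> \<Phi> = (THE z. \<exists>q v w. (q, v) \<in> \<Psi> \<and> (q, w) \<in> \<Phi> \<and> z = (\<Sum>k\<in>UNIV. v $ k * cnj (w $ k)))"

definition spinor_field ::
  "('p, 'n::finite, 's::finite, 'q, 'r) spinc \<Rightarrow> ('p \<Rightarrow> ('q, 's) spinor) \<Rightarrow> bool" where
  "spinor_field M \<psi> \<longleftrightarrow> (\<forall>p\<in>points M. \<psi> p \<in> spinor_fibre M p) \<and>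
     (\<forall>(U, s)\<in>trivs (spinc_bundle M). smooth_map M U (\<lambda>p. spinor_comp (\<psi> p) (s p)))"

text \<open>The covariant derivative along a tangent vector \<open>X\<close> at \<open>p\<close>. In a local section of the
  Spin-c bundle over the local frame \<open>(e\<^sub>i)\<close> and the local section \<open>t\<close> of the circle bundle
  it is \<open>X(\<psi>) + 1/4 \<Sum>\<^sub>i\<^sub>j g(\<nabla>\<^sub>X e\<^sub>i, e\<^sub>j) e\<^sub>i \<cdot> e\<^sub>j \<cdot> \<psi> + 1/2 A(X) \<psi>\<close> with \<open>A\<close> the pull-back along \<open>t\<close> of
  the imaginary valued connection form; the result is independent of the section. The last factor
  1/2 is due to \<open>spinc_det (z h) = z\<^sup>2\<close>.\<close>

definition spinc_deriv :: "('p, 'n::finite, 's::finite, 'q, 'r) spinc \<Rightarrow> ('p, 'n) tvec \<Rightarrow>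
    ('p \<Rightarrow> ('q, 's) spinor) \<Rightarrow> 'p \<Rightarrow> ('q, 's) spinor" where
  "spinc_deriv M X \<psi> p =
     (let (U, s) = (SOME (U, s). (U, s) \<in> trivs (spinc_bundle M) \<and> p \<in> U);
          e = (\<lambda>i y. frame_at M (s y) i);
          A = connection M (U, \<lambda>y. snd (cover M (s y)));
          \<phi> = (\<lambda>y. spinor_comp (\<psi> y) (s y))
      in spinor_class M (s p)
           (deriv_along M p X \<phi>
            + (1/4) *\<^sub>R (\<Sum>i\<in>UNIV. \<Sum>j\<in>UNIV. metric M p (levi_civita M X (e i) p) (e j p) *\<^sub>R
                ((gam M i ** gam M j) *v \<phi> p))
            + (A p X / 2) *s \<phi> p))"


section \<open>Imaginary generalized Killing spinors\<close>

definition imaginary_generalized_killing_spinor :: "('p, 'n::finite, 's::finite, 'q, 'r) spinc \<Rightarrow>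
    ('p \<Rightarrow> real) \<Rightarrow> ('p \<Rightarrow> ('q, 's) spinor) \<Rightarrow> bool" where
  "imaginary_generalized_killing_spinor M b \<psi> \<longleftrightarrow>
     smooth_map M (points M) b \<and> spinor_field M \<psi> \<and>
     (\<exists>p\<in>points M. \<psi> p \<noteq> zero_spinor M p) \<and>
     (\<forall>X. smooth_vector_field M (points M) X \<longrightarrow> (\<forall>p\<in>points M.
        spinc_deriv M (X p) \<psi> p =
        spinor_scale (\<i> * of_real (b p)) (cliff_mult M (X p) (\<psi> p))))"

definition spinor_norm_sq :: "('p \<Rightarrow> ('q, 's::finite) spinor) \<Rightarrow> 'p \<Rightarrow> real" where
  "spinor_norm_sq \<psi> p = Re (hprod (\<psi> p) (\<psi> p))"

definition dirac_current :: "('p, 'n::finite, 's::finite, 'q, 'r) spinc \<Rightarrow>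
    ('p \<Rightarrow> ('q, 's) spinor) \<Rightarrow> 'p \<Rightarrow> ('p, 'n) tvec" where
  "dirac_current M \<psi> p = (THE V. V \<in> tangent_space M p \<and> (\<forall>X\<in>tangent_space M p.
     of_real (metric M p V X) = \<i> * hprod (cliff_mult M X (\<psi> p)) (\<psi> p)))"

definition q_fun :: "('p, 'n::finite, 's::finite, 'q, 'r) spinc \<Rightarrow>
    ('p \<Rightarrow> ('q, 's) spinor) \<Rightarrow> 'p \<Rightarrow> real" where
  "q_fun M \<psi> p = (spinor_norm_sq \<psi> p)\<^sup>2
     - metric M p (dirac_current M \<psi> p) (dirac_current M \<psi> p)"

definition type_II :: "('p, 'n::finite, 's::finite, 'q, 'r) spinc \<Rightarrow>
    ('p \<Rightarrow> ('q, 's) spinor) \<Rightarrow> bool" where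
  "type_II M \<psi> \<longleftrightarrow> (\<exists>q>0. \<forall>p\<in>points M. q_fun M \<psi> p = q)"

end

theory Submission
  imports Defs
begin

text \<open>On the flat plane with trivial bundles write a spinor as \<open>(u, s)\<close>, so that
  \<open>q = (|u|\<^sup>2 - |s|\<^sup>2)\<^sup>2\<close>. The rotationally symmetric ansatz \<open>u = cosh t(r)\<close>,
  \<open>s = - \<i> (cnj z / |z|) sinh t(r)\<close> has \<open>q = 1\<close>. The radial part of the Killing equation becomes
  \<open>t' = b\<close>; its angular part determines the connection form and leaves the condition
  \<open>b r (tanh t + coth t) = 1\<close>. Together they are solved by \<open>sinh 2t = r\<close>, which gives
  \<open>b = 1 / (2 cosh 2t)\<close> with \<open>cosh 2t = sqrt (1 + r\<^sup>2)\<close>.\<close>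

section \<open>Calculus of smooth maps\<close>

text \<open>Clifford multiplication swaps u and s. Along the unit angular vector the u-equation
  therefore gives A/2 = i b tanh t, while the s-equation, to which the phase of s contributes -i/r,
  gives A/2 = i/r - i b coth t; equating the two is the stated condition. So this ansatz forces a
  nonzero connection form, which is where the Spin-c structure enters. As tanh t + coth t = 2 cosh
  2t / sinh 2t, inserting b = t' turns the condition into the linear equation r (sinh 2t)' = sinh
  2t. Its solutions are the multiples of r; the factor 1 is a normalisation. The polar formulas are
  singular at the origin. The half-angle identities sinh t = r / (2 cosh t) and tanh t = r / (1 +
  cosh 2t) rewrite the spinor and the connection form through square roots and inverses of positive
  functions, smooth on the whole plane. One chart and one global section collapse the choices hidden
  in the \<open>SOME\<close> operators. What remains is independence of representatives in a spinor
  class, and the transformation rule of the connection form for arbitrary smooth circle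
  sections.\<close>

lemma has_frechet_derivative:
  "f differentiable (at x) \<Longrightarrow> (f has_derivative frechet_derivative f (at x)) (at x)"
  by (simp add: frechet_derivative_works)

lemma frechet_derivative_eqI:
  "(f has_derivative f') (at x) \<Longrightarrow> frechet_derivative f (at x) = f'"
  by (metis frechet_derivative_at)

lemma has_derivative_cong_open:
  assumes "open S" "x \<in> S" "\<And>y. y \<in> S \<Longrightarrow> f y = g y" "(f has_derivative f') (at x)"
  shows "(g has_derivative f') (at x)"
  using has_derivative_transform_within_open[OF assms(4) assms(1,2)] assms(3) by metis

lemma frechet_derivative_cong_open:
  assumes "open S" "x \<in> S" "\<And>y. y \<in> S \<Longrightarrow> f y = g y" "f differentiable (at x)"
  shows "frechet_derivative g (at x) = frechet_derivative f (at x)"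
  using has_derivative_cong_open[OF assms(1-3) has_frechet_derivative[OF assms(4)]]
  by (rule frechet_derivative_eqI)

text \<open>Openness of \<open>S\<close> lets equality on \<open>S\<close> pass to the derivatives
  at its points, and hence to every order.\<close>

lemma ck_on_cong:
  assumes "open S" "\<And>x. x \<in> S \<Longrightarrow> f x = g x" "ck_on k S f"
  shows "ck_on k S g"
  using assms(2,3)
proof (induction k arbitrary: f g)
  case 0
  then show ?case by (simp cong: continuous_on_cong)
next
  case (Suc k)
  have d: "f differentiable (at x)" if "x \<in> S" for x using Suc.prems that by simp
  have e: "frechet_derivative g (at x) = frechet_derivative f (at x)" if "x \<in> S" for x
    using frechet_derivative_cong_open[OF assms(1) that Suc.prems(1) d[OF that]] by simp
  have "g differentiable (at x)" if "x \<in> S" for x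
    using has_derivative_cong_open[OF assms(1) that Suc.prems(1) has_frechet_derivative[OF d[OF that]]]
    by (auto simp: differentiable_def)
  moreover have "ck_on k S (\<lambda>x. frechet_derivative g (at x) v)" for v
    by (rule Suc.IH[of "\<lambda>x. frechet_derivative f (at x) v"]) (use Suc.prems(2) e in auto)
  ultimately show ?case by simp
qed

text \<open>\<open>frechet_derivative\<close> is only a choice operator. The closure rules below
  exhibit an explicit derivative instead, and uniqueness of derivatives transfers the
  regularity.\<close>

lemma ck_on_SucI:
  assumes "open S" "\<And>x. x \<in> S \<Longrightarrow> (f has_derivative f' x) (at x)" "\<And>v. ck_on k S (\<lambda>x. f' x v)"
  shows "ck_on (Suc k) S f"
proof -
  have "ck_on k S (\<lambda>x. frechet_derivative f (at x) v)" for v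
    by (rule ck_on_cong[OF assms(1) _ assms(3)[of v]])
       (simp add: frechet_derivative_eqI[OF assms(2)])
  then show ?thesis using assms(2) by (auto simp: differentiable_def)
qed

lemma ck_on_Suc_continuous: "ck_on (Suc k) S f \<Longrightarrow> continuous_on S f"
  by (simp add: continuous_at_imp_continuous_on differentiable_imp_continuous_within)

lemma ck_on_SucD: "ck_on (Suc k) S f \<Longrightarrow> ck_on k S f"
proof (induction k arbitrary: f)
  case 0
  then show ?case using ck_on_Suc_continuous[of 0] by simp
next
  case (Suc k)
  have "ck_on k S (\<lambda>x. frechet_derivative f (at x) v)" for v
    by (rule Suc.IH) (use Suc.prems in simp)
  then show ?case using Suc.prems by simp
qed

lemma ck_on_derivative:
  "ck_on (Suc k) S f \<Longrightarrow> ck_on k S (\<lambda>x. frechet_derivative f (at x) v)"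
  "ck_on (Suc k) S f \<Longrightarrow> x \<in> S \<Longrightarrow> (f has_derivative frechet_derivative f (at x)) (at x)"
  by (auto intro: has_frechet_derivative)

lemma ck_on_subset: "ck_on k S f \<Longrightarrow> T \<subseteq> S \<Longrightarrow> ck_on k T f"
  by (induction k arbitrary: f) (auto intro: continuous_on_subset)

lemma ck_on_const: "ck_on k S (\<lambda>_. c)"
  by (induction k arbitrary: c) auto

lemma ck_on_bounded_linear:
  assumes "open S" "bounded_linear L"
  shows "ck_on k S L"
proof (cases k)
  case 0
  then show ?thesis by (simp add: assms(2) linear_continuous_on)
next
  case (Suc n)
  show ?thesis unfolding Suc
    by (rule ck_on_SucI[OF assms(1) bounded_linear_imp_has_derivative[OF assms(2)] ck_on_const])
qed

lemma ck_on_add: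
  assumes "open S"
  shows "ck_on k S f \<Longrightarrow> ck_on k S g \<Longrightarrow> ck_on k S (\<lambda>x. f x + g x)"
proof (induction k arbitrary: f g)
  case 0
  then show ?case by (simp add: continuous_on_add)
next
  case (Suc k)
  show ?case
    by (rule ck_on_SucI[OF assms has_derivative_add]) (use Suc ck_on_derivative in blast)+
qed

text \<open>The product rule pairs an undifferentiated factor of order \<open>Suc k\<close> with a
  derivative of order \<open>k\<close>; lowering the former by \<open>ck_on_SucD\<close> makes the
  induction hypothesis applicable to both terms.\<close>

lemma ck_on_bilinear:
  assumes "open S" "bounded_bilinear B"
  shows "ck_on k S f \<Longrightarrow> ck_on k S g \<Longrightarrow> ck_on k S (\<lambda>x. B (f x) (g x))"
proof (induction k arbitrary: f g)
  case 0
  then show ?case using bounded_bilinear.continuous_on[OF assms(2)] by auto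
next
  case (Suc k)
  show ?case
  proof (rule ck_on_SucI[OF assms(1)])
    show "((\<lambda>x. B (f x) (g x)) has_derivative
        (\<lambda>v. B (f x) (frechet_derivative g (at x) v) + B (frechet_derivative f (at x) v) (g x))) (at x)"
      if "x \<in> S" for x
      by (rule bounded_bilinear.FDERIV[OF assms(2)]) (use ck_on_derivative(2) Suc.prems that in blast)+
    show "ck_on k S (\<lambda>x. B (f x) (frechet_derivative g (at x) v) + B (frechet_derivative f (at x) v) (g x))" for v
      using Suc.prems by (intro ck_on_add[OF assms(1)] Suc.IH ck_on_derivative(1)) (auto dest: ck_on_SucD simp del: ck_on.simps)
  qed
qed

lemma ck_on_linear_comp:
  assumes "open S" "bounded_linear L"
  shows "ck_on k S f \<Longrightarrow> ck_on k S (\<lambda>x. L (f x))"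
proof (induction k arbitrary: f)
  case 0
  then show ?case using linear_continuous_on_compose bounded_linear.continuous_on[OF assms(2)] by auto
next
  case (Suc k)
  show ?case
    by (rule ck_on_SucI[OF assms(1) bounded_linear.has_derivative[OF assms(2)]])
       (use Suc ck_on_derivative in blast)+
qed

lemma ck_on_inverse:
  fixes f :: "'a::real_normed_vector \<Rightarrow> 'b::real_normed_field"
  assumes "open S"
  shows "ck_on k S f \<Longrightarrow> (\<And>x. x \<in> S \<Longrightarrow> f x \<noteq> 0) \<Longrightarrow> ck_on k S (\<lambda>x. inverse (f x))"
proof (induction k arbitrary: f)
  case 0
  then show ?case by (simp add: continuous_on_inverse)
next
  case (Suc k)
  note m = bounded_bilinear_mult[where 'a='b]
  \<comment> \<open>The derivative of the inverse contains the inverse again, but only its order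
    \<open>k\<close> regularity is needed.\<close>
  have i: "ck_on k S (\<lambda>x. inverse (f x))"
    by (rule Suc.IH[OF ck_on_SucD[OF Suc.prems(1)] Suc.prems(2)])
  show ?case
  proof (rule ck_on_SucI[OF assms])
    show "((\<lambda>x. inverse (f x)) has_derivative
      (\<lambda>v. - (inverse (f x) * frechet_derivative f (at x) v * inverse (f x)))) (at x)" if "x \<in> S" for x
      using Deriv.has_derivative_inverse[OF Suc.prems(2)[OF that] ck_on_derivative(2)[OF Suc.prems(1) that]] .
    show "ck_on k S (\<lambda>x. - (inverse (f x) * frechet_derivative f (at x) v * inverse (f x)))" for v
      by (rule ck_on_linear_comp[OF assms bounded_linear_minus[OF bounded_linear_ident]])
         (intro ck_on_bilinear[OF assms m] i ck_on_derivative(1) Suc.prems(1))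
  qed
qed

lemma ck_on_sqrt:
  fixes f :: "'a::real_normed_vector \<Rightarrow> real"
  assumes "open S"
  shows "ck_on k S f \<Longrightarrow> (\<And>x. x \<in> S \<Longrightarrow> f x > 0) \<Longrightarrow> ck_on k S (\<lambda>x. sqrt (f x))"
proof (induction k arbitrary: f)
  case 0
  then show ?case by (simp add: continuous_on_real_sqrt)
next
  case (Suc k)
  have i: "ck_on k S (\<lambda>x. inverse (sqrt (f x)))"
    by (rule ck_on_inverse[OF assms Suc.IH[OF ck_on_SucD[OF Suc.prems(1)] Suc.prems(2)]])
       (use Suc.prems(2) in force)+
  show ?case
  proof (rule ck_on_SucI[OF assms])
    show "((\<lambda>x. sqrt (f x)) has_derivative
      (\<lambda>v. frechet_derivative f (at x) v * (inverse (sqrt (f x)) * (1/2)))) (at x)" if "x \<in> S" for x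
      using has_derivative_real_sqrt[OF Suc.prems(2)[OF that] ck_on_derivative(2)[OF Suc.prems(1) that]]
      by (simp add: field_simps)
    show "ck_on k S (\<lambda>x. frechet_derivative f (at x) v * (inverse (sqrt (f x)) * (1/2)))" for v
      by (intro ck_on_bilinear[OF assms bounded_bilinear_mult] i ck_on_derivative(1) Suc.prems(1) ck_on_const)
  qed
qed

section \<open>Closure rules at order infinity\<close>

lemma smooth_on_derivative: "smooth_on S f \<Longrightarrow> smooth_on S (\<lambda>x. frechet_derivative f (at x) v)"
  unfolding smooth_on_def using ck_on_derivative(1) by blast

lemma smooth_on_has_derivative:
  "smooth_on S f \<Longrightarrow> x \<in> S \<Longrightarrow> (f has_derivative frechet_derivative f (at x)) (at x)"
  unfolding smooth_on_def using ck_on_derivative(2) by blast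

lemma smooth_on_subset: "smooth_on S f \<Longrightarrow> T \<subseteq> S \<Longrightarrow> smooth_on T f"
  unfolding smooth_on_def using ck_on_subset by blast

lemma smooth_on_cong:
  "open S \<Longrightarrow> (\<And>x. x \<in> S \<Longrightarrow> f x = g x) \<Longrightarrow> smooth_on S f \<Longrightarrow> smooth_on S g"
  unfolding smooth_on_def using ck_on_cong[of S f g] by blast

lemma smooth_on_const: "smooth_on S (\<lambda>_. c)"
  by (simp add: smooth_on_def ck_on_const)

lemma smooth_on_bounded_linear: "open S \<Longrightarrow> bounded_linear L \<Longrightarrow> smooth_on S L"
  by (simp add: smooth_on_def ck_on_bounded_linear)

lemma smooth_on_bilinear:
  "open S \<Longrightarrow> bounded_bilinear B \<Longrightarrow> smooth_on S f \<Longrightarrow> smooth_on S g \<Longrightarrow> smooth_on S (\<lambda>x. B (f x) (g x))"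
  by (simp add: smooth_on_def ck_on_bilinear)

lemma smooth_on_add: "open S \<Longrightarrow> smooth_on S f \<Longrightarrow> smooth_on S g \<Longrightarrow> smooth_on S (\<lambda>x. f x + g x)"
  by (simp add: smooth_on_def ck_on_add)

lemma smooth_on_linear_comp:
  "open S \<Longrightarrow> bounded_linear L \<Longrightarrow> smooth_on S f \<Longrightarrow> smooth_on S (\<lambda>x. L (f x))"
  by (simp add: smooth_on_def ck_on_linear_comp)

lemma smooth_on_mult:
  fixes f g :: "'a::real_normed_vector \<Rightarrow> 'b::real_normed_algebra"
  shows "open S \<Longrightarrow> smooth_on S f \<Longrightarrow> smooth_on S g \<Longrightarrow> smooth_on S (\<lambda>x. f x * g x)"
  by (rule smooth_on_bilinear[OF _ bounded_bilinear_mult])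

lemma smooth_on_inverse:
  fixes f :: "'a::real_normed_vector \<Rightarrow> 'b::real_normed_field"
  shows "open S \<Longrightarrow> smooth_on S f \<Longrightarrow> (\<And>x. x \<in> S \<Longrightarrow> f x \<noteq> 0) \<Longrightarrow> smooth_on S (\<lambda>x. inverse (f x))"
  by (simp add: smooth_on_def ck_on_inverse)

lemma smooth_on_sqrt:
  fixes f :: "'a::real_normed_vector \<Rightarrow> real"
  shows "open S \<Longrightarrow> smooth_on S f \<Longrightarrow> (\<And>x. x \<in> S \<Longrightarrow> f x > 0) \<Longrightarrow> smooth_on S (\<lambda>x. sqrt (f x))"
  by (simp add: smooth_on_def ck_on_sqrt)

section \<open>Spin groups in dimension two\<close>

definition mat2 :: "'a \<Rightarrow> 'a \<Rightarrow> 'a \<Rightarrow> 'a \<Rightarrow> 'a ^ 2 ^ 2" where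
  "mat2 a b c d = (\<chi> i j. if i = 1 then if j = 1 then a else b else if j = 1 then c else d)"

lemma mat2_nth [simp]:
  "mat2 a b c d $ 1 $ 1 = a" "mat2 a b c d $ 1 $ 2 = b"
  "mat2 a b c d $ 2 $ 1 = c" "mat2 a b c d $ 2 $ 2 = d"
  by (simp_all add: mat2_def)

lemma matrix_2_eq_iff:
  fixes A B :: "'a ^ 2 ^ 2"
  shows "A = B \<longleftrightarrow> A $ 1 $ 1 = B $ 1 $ 1 \<and> A $ 1 $ 2 = B $ 1 $ 2 \<and>
    A $ 2 $ 1 = B $ 2 $ 1 \<and> A $ 2 $ 2 = B $ 2 $ 2"
  by (auto simp: vec_eq_iff forall_2)

lemma vec_2_eq_iff:
  fixes v w :: "'a ^ 2"
  shows "v = w \<longleftrightarrow> v $ 1 = w $ 1 \<and> v $ 2 = w $ 2"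
  by (auto simp: vec_eq_iff forall_2)

lemma mat2_inject [simp]:
  "mat2 a b c d = mat2 a' b' c' d' \<longleftrightarrow> a = a' \<and> b = b' \<and> c = c' \<and> d = d'"
  by (simp add: matrix_2_eq_iff)

lemma mat2_mult:
  fixes a :: "'a::semiring_1"
  shows "mat2 a b c d ** mat2 a' b' c' d' =
    mat2 (a * a' + b * c') (a * b' + b * d') (c * a' + d * c') (c * b' + d * d')"
  by (simp add: matrix_2_eq_iff matrix_matrix_mult_def sum_2)

lemma mat_eq_mat2: "mat z = mat2 z 0 0 z"
  by (simp add: matrix_2_eq_iff mat_def)

lemma mat2_mult_vec_nth:
  fixes a :: "'a::semiring_1"
  shows "(mat2 a b c d *v v) $ 1 = a * v $ 1 + b * v $ 2" "(mat2 a b c d *v v) $ 2 = c * v $ 1 + d * v $ 2"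
  by (simp_all add: matrix_vector_mult_def sum_2)

text \<open>Identifies the plane with the complex numbers, so that rotations and Clifford
  multiplication become complex multiplication.\<close>

definition cplx :: "real ^ 2 \<Rightarrow> complex" where
  "cplx v = Complex (v $ 1) (v $ 2)"

lemma cplx_inject [simp]: "cplx v = cplx w \<longleftrightarrow> v = w"
  by (simp add: cplx_def vec_2_eq_iff)

lemma cmod_cplx [simp]: "cmod (cplx v) = norm v"
  by (simp add: cplx_def cmod_def norm_vec_def L2_set_def sum_2)

lemma cplx_surj: "\<exists>v. cplx v = z"
  by (rule exI[of _ "vector [Re z, Im z]"]) (simp add: cplx_def vector_def)

definition rot2 :: "complex \<Rightarrow> real ^ 2 ^ 2" where
  "rot2 w = mat2 (Re w) (- Im w) (Im w) (Re w)"

lemma cplx_rot2: "cplx (rot2 w *v v) = w * cplx v"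
  by (simp add: cplx_def rot2_def mat2_mult_vec_nth complex_eq_iff)

lemma rot2_mult: "rot2 (w * w') = rot2 w ** rot2 w'"
  by (simp add: rot2_def mat2_mult algebra_simps)

text \<open>Chosen so that a vector acts by an off-diagonal matrix with entries z and minus its
  conjugate; even elements are then diagonal and both spin groups consist of diagonal
  matrices.\<close>

definition gamma2 :: "2 \<Rightarrow> complex ^ 2 ^ 2" where
  "gamma2 i = (if i = 1 then mat2 0 1 (-1) 0 else mat2 0 \<i> \<i> 0)"

lemma gamma2_nth [simp]: "gamma2 1 = mat2 0 1 (-1) 0" "gamma2 2 = mat2 0 \<i> \<i> 0"
  by (simp_all add: gamma2_def)

lemma spin_module_gamma2: "spin_module gamma2"
  by (simp add: spin_module_def forall_2 mat2_mult mat_eq_mat2) (simp add: matrix_2_eq_iff)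

lemma cliff_gamma2: "cliff gamma2 v = mat2 0 (cplx v) (- cnj (cplx v)) 0"
  by (simp add: cliff_def sum_2 cplx_def matrix_2_eq_iff complex_eq_iff)

lemma cliff_gamma2_inject [simp]: "cliff gamma2 v = cliff gamma2 w \<longleftrightarrow> v = w"
  by (auto simp: cliff_gamma2)

lemma unit_mult_cnj: "cmod z = 1 \<Longrightarrow> z * cnj z = 1"
  by (simp add: complex_norm_square [symmetric])

text \<open>Spin(2) is a circle: the product of two off-diagonal matrices from unit vectors is
  diagonal with conjugate unit entries.\<close>

lemma spin_group_gamma2: "spin_group gamma2 = {mat2 e 0 0 (cnj e) | e. cmod e = 1}"
proof (intro equalityI subsetI)
  fix h assume "h \<in> spin_group gamma2"
  then show "h \<in> {mat2 e 0 0 (cnj e) | e. cmod e = 1}"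
  proof induction
    case one
    show ?case by (auto simp: mat_eq_mat2 intro!: exI[of _ 1])
  next
    case (step u v h)
    then obtain e where "h = mat2 e 0 0 (cnj e)" "cmod e = 1" by auto
    then show ?case using step(1,2)
      by (auto simp: cliff_gamma2 mat2_mult norm_mult
          intro!: exI[of _ "- (cplx u * cnj (cplx v) * e)"])
  qed
next
  fix h assume "h \<in> {mat2 e 0 0 (cnj e) | e. cmod e = 1}"
  then obtain e where h: "h = mat2 e 0 0 (cnj e)" and e: "cmod e = 1" by auto
  \<comment> \<open>One pair of vectors already reaches every element: with second factor -1 the
    product has first entry \<open>cplx u\<close>.\<close>
  obtain u v where uv: "cplx u = e" "cplx v = -1" using cplx_surj by metis
  have "norm u = 1" "norm v = 1" using e by (metis uv cmod_cplx norm_minus_cancel norm_one)+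
  then have "cliff gamma2 u ** cliff gamma2 v ** mat 1 \<in> spin_group gamma2"
    by (intro spin_group.intros)
  then show "h \<in> spin_group gamma2"
    by (simp add: h cliff_gamma2 uv mat2_mult mat_eq_mat2)
qed

text \<open>Spin-c(2) is the full diagonal torus, since the scalar z and the Spin element with entry
  e multiply to the pair (z e, z cnj e).\<close>

lemma spinc_group_gamma2: "spinc_group gamma2 = {mat2 a 0 0 d | a d. cmod a = 1 \<and> cmod d = 1}"
proof (intro equalityI subsetI)
  fix h assume "h \<in> spinc_group gamma2"
  then show "h \<in> {mat2 a 0 0 d | a d. cmod a = 1 \<and> cmod d = 1}"
    by (auto simp: spinc_group_def spin_group_gamma2 mat_eq_mat2 mat2_mult norm_mult)
next
  fix h assume "h \<in> {mat2 a 0 0 d | a d. cmod a = 1 \<and> cmod d = 1}"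
  then obtain a d where h: "h = mat2 a 0 0 d" and ad: "cmod a = 1" "cmod d = 1" by auto
  \<comment> \<open>Forced up to sign: the entries z e and z cnj e multiply to z squared, and then e
    = a cnj z.\<close>
  define z where "z = csqrt (a * d)"
  have zz: "z * z = a * d" by (simp add: z_def flip: power2_eq_square)
  have z1: "cmod z = 1" by (simp add: z_def norm_mult ad)
  have "z * (a * cnj z) = a" using unit_mult_cnj[OF z1] by (simp add: algebra_simps)
  moreover have "z * cnj (a * cnj z) = d"
  proof -
    have "z * cnj (a * cnj z) = (z * z) * cnj a" by simp
    also have "\<dots> = d * (a * cnj a)" by (simp only: zz mult_ac)
    finally show ?thesis by (simp add: unit_mult_cnj[OF ad(1)])
  qed
  ultimately have "h = mat z ** mat2 (a * cnj z) 0 0 (cnj (a * cnj z))"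
    by (simp add: h mat_eq_mat2 mat2_mult)
  moreover have "cmod (a * cnj z) = 1" by (simp add: norm_mult z1 ad)
  ultimately show "h \<in> spinc_group gamma2"
    using z1 by (force simp: spinc_group_def spin_group_gamma2)
qed

lemma spinc_group_gamma2E:
  assumes "h \<in> spinc_group gamma2"
  obtains a d where "h = mat2 a 0 0 d" "cmod a = 1" "cmod d = 1"
  using assms by (auto simp: spinc_group_gamma2)

lemma matrix_inv_eqI:
  fixes A :: "'a::semiring_1 ^ 'n::finite ^ 'n"
  assumes "A ** B = mat 1" "B ** A = mat 1"
  shows "matrix_inv A = B"
proof -
  have "A ** matrix_inv A = mat 1 \<and> matrix_inv A ** A = mat 1"
    unfolding matrix_inv_def by (rule someI[of _ B]) (use assms in simp)
  then show ?thesis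
    using assms by (metis matrix_mul_assoc matrix_mul_lid matrix_mul_rid)
qed

lemma matrix_inv_diag:
  assumes "cmod a = 1" "cmod d = 1"
  shows "matrix_inv (mat2 a 0 0 d) = mat2 (cnj a) 0 0 (cnj d)"
  by (rule matrix_inv_eqI)
     (use assms[THEN unit_mult_cnj] in \<open>simp_all add: mat2_mult mat_eq_mat2 mult.commute\<close>)

text \<open>Conjugation by a diagonal matrix multiplies the upper off-diagonal entry by
  \<open>a * cnj d\<close>. Injectivity of \<open>cliff gamma2\<close> makes the rotation
  unique.\<close>

lemma spinc_Ad_gamma2:
  assumes "cmod a = 1" "cmod d = 1"
  shows "spinc_Ad gamma2 (mat2 a 0 0 d) = rot2 (a * cnj d)"
  unfolding spinc_Ad_def
proof (rule the_equality)
  show *: "\<forall>v. cliff gamma2 (rot2 (a * cnj d) *v v) =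
      mat2 a 0 0 d ** cliff gamma2 v ** matrix_inv (mat2 a 0 0 d)"
    by (simp add: cliff_gamma2 cplx_rot2 matrix_inv_diag[OF assms] mat2_mult mult_ac)
  fix B assume "\<forall>v. cliff gamma2 (B *v v) =
      mat2 a 0 0 d ** cliff gamma2 v ** matrix_inv (mat2 a 0 0 d)"
  with * have "B *v v = rot2 (a * cnj d) *v v" for v by (metis cliff_gamma2_inject)
  then show "B = rot2 (a * cnj d)" by (simp add: matrix_eq)
qed

text \<open>Elements of the spin group have matrix determinant 1, so every admissible decomposition
  yields the same square, the determinant of the matrix.\<close>

lemma spinc_det_gamma2:
  assumes "cmod a = 1" "cmod d = 1"
  shows "spinc_det gamma2 (mat2 a 0 0 d) = a * d"
proof -
  have det: "z\<^sup>2 = a * d" if "k \<in> spin_group gamma2" "mat2 a 0 0 d = mat z ** k" for z k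
  proof -
    obtain e where e: "k = mat2 e 0 0 (cnj e)" "cmod e = 1" using \<open>k \<in> _\<close> by (auto simp: spin_group_gamma2)
    then have "a = z * e" "d = z * cnj e" using that(2) by (auto simp: mat_eq_mat2 mat2_mult)
    then have "a * d = z\<^sup>2 * (e * cnj e)" by (simp add: power2_eq_square)
    then show ?thesis using unit_mult_cnj[OF e(2)] by simp
  qed
  have "mat2 a 0 0 d \<in> spinc_group gamma2" using assms by (auto simp: spinc_group_gamma2)
  then obtain z k where zk: "cmod z = 1" "k \<in> spin_group gamma2" "mat2 a 0 0 d = mat z ** k"
    by (auto simp: spinc_group_def)
  have "a * d = z\<^sup>2" using det[OF zk(2,3)] by simp
  with zk show ?thesis
    unfolding spinc_det_def by (intro the_equality) (blast, use det in blast)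
qed

lemma spinc_group_gamma2_mult:
  assumes "h \<in> spinc_group gamma2" "k \<in> spinc_group gamma2"
  shows "h ** k \<in> spinc_group gamma2"
    "spinc_Ad gamma2 (h ** k) = spinc_Ad gamma2 h ** spinc_Ad gamma2 k"
    "spinc_det gamma2 (h ** k) = spinc_det gamma2 h * spinc_det gamma2 k"
proof -
  obtain a d where h: "h = mat2 a 0 0 d" "cmod a = 1" "cmod d = 1"
    using assms(1) by (rule spinc_group_gamma2E)
  obtain a' d' where k: "k = mat2 a' 0 0 d'" "cmod a' = 1" "cmod d' = 1"
    using assms(2) by (rule spinc_group_gamma2E)
  have hk: "h ** k = mat2 (a * a') 0 0 (d * d')" by (simp add: h k mat2_mult)
  have n: "cmod (a * a') = 1" "cmod (d * d') = 1" by (simp_all add: norm_mult h k)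
  show "h ** k \<in> spinc_group gamma2" using n by (auto simp: hk spinc_group_gamma2)
  show "spinc_Ad gamma2 (h ** k) = spinc_Ad gamma2 h ** spinc_Ad gamma2 k"
    unfolding hk spinc_Ad_gamma2[OF n]
    by (simp add: h k spinc_Ad_gamma2 flip: rot2_mult) (simp add: mult_ac)
  show "spinc_det gamma2 (h ** k) = spinc_det gamma2 h * spinc_det gamma2 k"
    unfolding hk spinc_det_gamma2[OF n] by (simp add: h k spinc_det_gamma2)
qed

lemma mat_1_in_spinc_group_gamma2 [simp]: "mat 1 \<in> spinc_group gamma2"
  by (auto simp: spinc_group_gamma2 mat_eq_mat2)

lemma cmod_spinc_det_gamma2: "h \<in> spinc_group gamma2 \<Longrightarrow> cmod (spinc_det gamma2 h) = 1"
  by (auto simp: spinc_group_gamma2 spinc_det_gamma2 norm_mult)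

lemma spinc_group_gamma2_inverse:
  assumes "h \<in> spinc_group gamma2"
  obtains k where "k \<in> spinc_group gamma2" "h ** k = mat 1" "k ** h = mat 1"
proof -
  obtain a d where h: "h = mat2 a 0 0 d" "cmod a = 1" "cmod d = 1"
    using assms by (rule spinc_group_gamma2E)
  show thesis
    by (rule that[of "mat2 (cnj a) 0 0 (cnj d)"])
       (use h(2,3)[THEN unit_mult_cnj] h in
         \<open>auto simp: spinc_group_gamma2 mat2_mult mat_eq_mat2 mult.commute\<close>)
qed

section \<open>Spin-c structures on the flat plane\<close>

definition std_chart :: "(real ^ 2, 2) chart" where
  "std_chart = (UNIV, \<lambda>x. x)"

text \<open>The value 0 at all other charts is the one that \<open>tangent_space\<close> prescribes
  outside the atlas.\<close>

definition const_tvec :: "real ^ 2 \<Rightarrow> (real ^ 2, 2) tvec" where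
  "const_tvec w = (\<lambda>c. if c = std_chart then w else 0)"

definition plane_spin_bundle :: "(real ^ 2, complex ^ 2 ^ 2, (real ^ 2) \<times> (complex ^ 2 ^ 2)) pbundle" where
  "plane_spin_bundle =
    \<lparr>total = UNIV \<times> spinc_group gamma2, proj = fst, act = (\<lambda>q h. (fst q, snd q ** h)),
     trivs = {(UNIV, \<lambda>p. (p, mat 1))}\<rparr>"

definition plane_circle_bundle :: "(real ^ 2, complex, (real ^ 2) \<times> complex) pbundle" where
  "plane_circle_bundle =
    \<lparr>total = UNIV \<times> circle, proj = fst, act = (\<lambda>q h. (fst q, snd q * h)),
     trivs = {(UNIV, \<lambda>p. (p, 1))}\<rparr>"

text \<open>In another section \<open>t = (p, \<tau> p)\<close> of the trivial circle bundle the form \<open>A\<close> is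
  changed by \<open>\<tau>\<^sup>-\<^sup>1 d\<tau>\<close>.\<close>

definition plane_spinc :: "(real ^ 2 \<Rightarrow> real ^ 2 \<Rightarrow> complex) \<Rightarrow>
    (real ^ 2, 2, 2, (real ^ 2) \<times> (complex ^ 2 ^ 2), (real ^ 2) \<times> complex) spinc" where
  "plane_spinc A =
    \<lparr>space_of = euclidean, charts = {std_chart}, metric = (\<lambda>p X Y. X std_chart \<bullet> Y std_chart),
     gam = gamma2, spinc_bundle = plane_spin_bundle, circle_bundle = plane_circle_bundle,
     cover = (\<lambda>q. (\<lambda>j. const_tvec (column j (spinc_Ad gamma2 (snd q))),
       (fst q, spinc_det gamma2 (snd q)))),
     connection = (\<lambda>s p X. A p (X std_chart) + inverse (snd (snd s p)) *
       frechet_derivative (\<lambda>y. snd (snd s y)) (at p) (X std_chart))\<rparr>"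

lemma plane_spinc_simps [simp]:
  "space_of (plane_spinc A) = euclidean"
  "charts (plane_spinc A) = {std_chart}"
  "metric (plane_spinc A) p X Y = X std_chart \<bullet> Y std_chart"
  "gam (plane_spinc A) = gamma2"
  "spinc_bundle (plane_spinc A) = plane_spin_bundle"
  "circle_bundle (plane_spinc A) = plane_circle_bundle"
  "cover (plane_spinc A) q = (\<lambda>j. const_tvec (column j (spinc_Ad gamma2 (snd q))),
     (fst q, spinc_det gamma2 (snd q)))"
  "connection (plane_spinc A) s p X = A p (X std_chart) + inverse (snd (snd s p)) *
       frechet_derivative (\<lambda>y. snd (snd s y)) (at p) (X std_chart)"
  by (simp_all add: plane_spinc_def)

lemma plane_bundle_simps [simp]:
  "total plane_spin_bundle = UNIV \<times> spinc_group gamma2"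
  "proj plane_spin_bundle q = fst q"
  "act plane_spin_bundle q h = (fst q, snd q ** h)"
  "trivs plane_spin_bundle = {(UNIV, \<lambda>p. (p, mat 1))}"
  "total plane_circle_bundle = UNIV \<times> circle"
  "proj plane_circle_bundle r = fst r"
  "act plane_circle_bundle r z = (fst r, snd r * z)"
  "trivs plane_circle_bundle = {(UNIV, \<lambda>p. (p, 1))}"
  by (simp_all add: plane_spin_bundle_def plane_circle_bundle_def)

lemma std_chart_simps [simp]:
  "fst std_chart = UNIV" "snd std_chart = (\<lambda>x. x)" "cinv std_chart = (\<lambda>x. x)"
  "transition std_chart std_chart = (\<lambda>x. x)"
proof -
  show *: "fst std_chart = UNIV" "snd std_chart = (\<lambda>x. x)" by (simp_all add: std_chart_def)
  show "cinv std_chart = (\<lambda>x. x)"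
    unfolding cinv_def * by (rule ext) (metis UNIV_I f_inv_into_f image_ident)
  then show "transition std_chart std_chart = (\<lambda>x. x)"
    by (simp add: transition_def * o_def)
qed

lemma const_tvec_std_chart [simp]: "const_tvec w std_chart = w"
  by (simp add: const_tvec_def)

lemma frechet_derivative_identity [simp]: "frechet_derivative (\<lambda>x. x) (at x) = (\<lambda>v. v)"
  by (rule frechet_derivative_eqI) (rule has_derivative_ident)

lemma frechet_derivative_constant [simp]: "frechet_derivative (\<lambda>x. c) (at x) = (\<lambda>v. 0)"
  by (rule frechet_derivative_eqI) (rule has_derivative_const)

lemma tangent_space_plane [simp]: "tangent_space (plane_spinc A) p = range const_tvec"
proof (intro equalityI subsetI)
  fix X assume "X \<in> tangent_space (plane_spinc A) p"
  then have "X = const_tvec (X std_chart)" by (auto simp: tangent_space_def const_tvec_def)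
  then show "X \<in> range const_tvec" by blast
qed (auto simp: tangent_space_def const_tvec_def)

lemma tvec_of_plane [simp]: "tvec_of (plane_spinc A) std_chart p w = const_tvec w"
  unfolding tvec_of_def const_tvec_def by (rule ext) (auto simp del: split_paired_All)

lemma metric_coeff_plane: "metric_coeff (plane_spinc A) std_chart i j = (\<lambda>x. (axis i 1 :: real ^ 2) \<bullet> axis j 1)"
  by (rule ext) (simp add: metric_coeff_def coord_vec_def)

lemma chart_at_plane [simp]: "chart_at (plane_spinc A) p = std_chart"
  by (auto simp: chart_at_def intro!: some_equality)

lemma deriv_along_plane [simp]:
  "deriv_along (plane_spinc A) p X f = frechet_derivative f (at p) (X std_chart)"
  by (simp add: deriv_along_def o_def)

text \<open>The metric coefficients are constant, so the Christoffel symbols vanish.\<close>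

lemma levi_civita_plane:
  "levi_civita (plane_spinc A) X Y p =
    const_tvec (\<chi> k. frechet_derivative (\<lambda>y. Y y std_chart $ k) (at p) (X std_chart))"
  by (simp add: levi_civita_def christoffel_def metric_coeff_plane pderiv_at_def)

lemma smooth_map_plane [simp]: "smooth_map (plane_spinc A) U f \<longleftrightarrow> smooth_on U f"
  by (simp add: smooth_map_def o_def)

lemma smooth_vector_field_plane:
  "smooth_vector_field (plane_spinc A) U X \<longleftrightarrow>
    (\<forall>p\<in>U. X p \<in> range const_tvec) \<and> smooth_on U (\<lambda>p. X p std_chart)"
  by (simp add: smooth_vector_field_def)

text \<open>Relative to the global section with value 1, the transition function of \<open>t\<close>
  is its own second component.\<close>

lemma smooth_sections_plane_circle:
  "(U, t) \<in> smooth_sections (plane_spinc A) circle plane_circle_bundle \<longleftrightarrow>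
    open U \<and> (\<forall>p\<in>U. fst (t p) = p \<and> cmod (snd (t p)) = 1) \<and> smooth_on U (\<lambda>p. snd (t p))"
proof
  assume L: "(U, t) \<in> smooth_sections (plane_spinc A) circle plane_circle_bundle"
  then obtain h where U: "open U" and h: "smooth_on U h" "\<And>p. p \<in> U \<Longrightarrow> cmod (h p) = 1 \<and> t p = (p, h p)"
    by (auto simp: smooth_sections_def)
  have "smooth_on U (\<lambda>p. snd (t p))" by (rule smooth_on_cong[OF U _ h(1)]) (simp add: h(2))
  then show "open U \<and> (\<forall>p\<in>U. fst (t p) = p \<and> cmod (snd (t p)) = 1) \<and> smooth_on U (\<lambda>p. snd (t p))"
    using U h(2) by simp
next
  assume R: "open U \<and> (\<forall>p\<in>U. fst (t p) = p \<and> cmod (snd (t p)) = 1) \<and> smooth_on U (\<lambda>p. snd (t p))"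
  then show "(U, t) \<in> smooth_sections (plane_spinc A) circle plane_circle_bundle"
    by (auto simp: smooth_sections_def mem_Times_iff prod_eq_iff intro!: exI[of _ "\<lambda>p. snd (t p)"])
qed

lemma oriented_riemannian_plane: "oriented_riemannian_manifold (plane_spinc A)"
proof -
  have "oriented_manifold (plane_spinc A)"
    unfolding oriented_manifold_def
  proof (intro conjI)
    show "Hausdorff_space (space_of (plane_spinc A))" by simp
    show "second_countable (space_of (plane_spinc A))"
    proof -
      obtain B :: "(real ^ 2) set set" where B: "countable B" "\<And>C. C \<in> B \<Longrightarrow> open C"
        "\<And>S. open S \<Longrightarrow> \<exists>U. U \<subseteq> B \<and> S = \<Union> U"
        using univ_second_countable by blast
      have "\<exists>V\<in>B. x \<in> V \<and> V \<subseteq> S" if "open S" "x \<in> S" for S x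
        using B(3)[OF that(1)] that(2) by blast
      then show ?thesis
        unfolding second_countable_def using B(1,2) by (intro exI[of _ B]) auto
    qed
    show "points (plane_spinc A) = \<Union> (fst ` charts (plane_spinc A))" by simp
    show "\<forall>(U, \<phi>)\<in>charts (plane_spinc A). openin (space_of (plane_spinc A)) U \<and> open (\<phi> ` U) \<and>
        homeomorphic_map (subtopology (space_of (plane_spinc A)) U) (top_of_set (\<phi> ` U)) \<phi>"
      using homeomorphic_map_id[of euclidean euclidean] by (simp add: std_chart_def id_def)
    show "\<forall>c\<in>charts (plane_spinc A). \<forall>d\<in>charts (plane_spinc A).
        smooth_on (snd c ` (fst c \<inter> fst d)) (transition c d) \<and>
        (\<forall>x \<in> snd c ` (fst c \<inter> fst d).
           det (matrix (frechet_derivative (transition c d) (at x))) > 0)"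
      using smooth_on_bounded_linear[OF open_UNIV bounded_linear_ident[where 'a="real ^ 2"]]
      by (simp add: matrix_id_mat_1[unfolded id_def])
  qed
  moreover have "w \<noteq> 0" if "const_tvec w \<noteq> (\<lambda>_. 0)" for w
    using that by (auto simp: const_tvec_def)
  ultimately show ?thesis
    by (auto simp: oriented_riemannian_manifold_def metric_coeff_plane smooth_on_const
        inner_commute tlin_def inner_add_right)
qed

section \<open>The trivial bundles and the equivariant cover\<close>

lemma principal_bundle_plane_spin:
  "principal_bundle (plane_spinc A) (spinc_group gamma2) (**) (mat 1) plane_spin_bundle"
proof -
  have ex1: "\<exists>!h. h \<in> spinc_group gamma2 \<and> g' = g ** h"
    if g: "g \<in> spinc_group gamma2" and g': "g' \<in> spinc_group gamma2" for g g'
  proof -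
    obtain k where k: "k \<in> spinc_group gamma2" "g ** k = mat 1" "k ** g = mat 1"
      using g by (rule spinc_group_gamma2_inverse)
    show ?thesis
    proof (rule ex1I[of _ "k ** g'"])
      show "k ** g' \<in> spinc_group gamma2 \<and> g' = g ** (k ** g')"
        using k g' by (simp add: spinc_group_gamma2_mult matrix_mul_assoc)
      show "h = k ** g'" if "h \<in> spinc_group gamma2 \<and> g' = g ** h" for h
        using that k by (simp add: matrix_mul_assoc)
    qed
  qed
  \<comment> \<open>A nonempty fibre is what makes the projection of the product onto.\<close>
  have inh: "spinc_group gamma2 \<noteq> {}" using mat_1_in_spinc_group_gamma2 by blast
  have "(UNIV, \<lambda>p. (p, mat 1)) \<in> smooth_sections (plane_spinc A) (spinc_group gamma2) plane_spin_bundle"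
    by (auto simp: smooth_sections_def smooth_on_const intro!: exI[of _ "\<lambda>_. mat 1"])
  with ex1 inh show ?thesis
    by (auto simp: principal_bundle_def spinc_group_gamma2_mult matrix_mul_assoc mem_Times_iff prod_eq_iff)
qed

lemma principal_bundle_plane_circle:
  "principal_bundle (plane_spinc A) circle (*) 1 plane_circle_bundle"
proof -
  have ex1: "\<exists>!h. cmod h = 1 \<and> g' = g * h" if "cmod g = 1" "cmod g' = 1" for g g'
    by (rule ex1I[of _ "g' / g"]) (use that in \<open>auto simp: norm_divide\<close>)
  have inh: "circle \<noteq> {}" by (auto intro!: exI[of _ 1])
  have "(UNIV, \<lambda>p. (p, 1)) \<in> smooth_sections (plane_spinc A) circle plane_circle_bundle"
    by (simp add: smooth_sections_plane_circle smooth_on_const)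
  with ex1 inh show ?thesis
    by (auto simp: principal_bundle_def norm_mult mem_Times_iff prod_eq_iff mult.assoc)
qed

text \<open>The columns of the rotation by a unit \<open>w\<close> are orthonormal, and its
  determinant is the squared modulus of \<open>w\<close>.\<close>

lemma oriented_frame_plane:
  assumes "h \<in> spinc_group gamma2"
  shows "oriented_frame (plane_spinc A) p (\<lambda>j. const_tvec (column j (spinc_Ad gamma2 h)))"
proof -
  obtain a d where h: "h = mat2 a 0 0 d" "cmod a = 1" "cmod d = 1"
    using assms by (rule spinc_group_gamma2E)
  define w where "w = a * cnj d"
  have "cmod w = 1" by (simp add: w_def norm_mult h)
  then have "Re w * Re w + Im w * Im w = 1" by (simp add: cmod_def power2_eq_square)
  moreover have "spinc_Ad gamma2 h = rot2 w" by (simp add: w_def h spinc_Ad_gamma2)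
  ultimately show ?thesis
    by (simp add: oriented_frame_def forall_2 inner_vec_def sum_2 column_def rot2_def det_2)
qed

lemma frame_act_plane:
  "frame_act (\<lambda>j. const_tvec (column j B)) C = (\<lambda>j. const_tvec (column j (B ** C)))"
  by (auto simp: frame_act_def const_tvec_def fun_eq_iff vec_eq_iff column_def matrix_matrix_mult_def
      mult.commute)

lemma spinc_structure_plane: "spinc_structure (plane_spinc A)"
  unfolding spinc_structure_def
proof (intro conjI)
  show "spin_module (gam (plane_spinc A))" by (simp add: spin_module_gamma2)
  show "principal_bundle (plane_spinc A) (spinc_group (gam (plane_spinc A))) (**) (mat 1)
      (spinc_bundle (plane_spinc A))"
    by (simp add: principal_bundle_plane_spin)
  show "principal_bundle (plane_spinc A) circle (*) 1 (circle_bundle (plane_spinc A))"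
    by (simp add: principal_bundle_plane_circle)
qed (auto simp: oriented_frame_plane cmod_spinc_det_gamma2 spinc_group_gamma2_mult frame_act_plane
    smooth_vector_field_plane smooth_on_const smooth_sections_plane_circle)

text \<open>Differentiate \<open>|f|\<^sup>2 = 1\<close>.\<close>

lemma Re_log_derivative_unit:
  fixes f :: "'a::real_normed_vector \<Rightarrow> complex"
  assumes "open U" "p \<in> U" "\<And>x. x \<in> U \<Longrightarrow> cmod (f x) = 1" "(f has_derivative f') (at p)"
  shows "Re (inverse (f p) * f' v) = 0"
proof -
  have "((\<lambda>x. f x \<bullet> f x) has_derivative (\<lambda>v. f p \<bullet> f' v + f' v \<bullet> f p)) (at p)"
    by (rule has_derivative_inner[OF assms(4,4)])
  moreover have "((\<lambda>x. f x \<bullet> f x) has_derivative (\<lambda>v. 0)) (at p)"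
    by (rule has_derivative_cong_open[OF assms(1,2) _ has_derivative_const[of 1]])
       (simp add: assms(3) dot_square_norm)
  ultimately have "f p \<bullet> f' v + f' v \<bullet> f p = 0"
    by (metis frechet_derivative_eqI)
  moreover have "inverse (f p) = cnj (f p)"
    using assms(2,3) by (intro inverse_unique unit_mult_cnj)
  ultimately show ?thesis by (simp add: inner_complex_def inner_commute)
qed

text \<open>The logarithmic derivative of a unit function is imaginary, and by the product rule that
  of a product is the sum of those of the factors, which is the required change under
  \<open>h\<close>.\<close>

lemma circle_connection_plane:
  assumes smooth: "\<And>v. smooth_on UNIV (\<lambda>x. A x v)"
    and lin: "\<And>x. linear (A x)" and im: "\<And>x v. Re (A x v) = 0"
  shows "circle_connection (plane_spinc A)"
  unfolding circle_connection_def
proof (intro ballI, clarify, intro conjI ballI allI impI)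
  let ?S = "smooth_sections (plane_spinc A) circle (circle_bundle (plane_spinc A))"
  fix U and t assume "(U, t) \<in> ?S"
  then have U: "open U" and t: "\<And>p. p \<in> U \<Longrightarrow> fst (t p) = p \<and> cmod (snd (t p)) = 1"
    and st: "smooth_on U (\<lambda>p. snd (t p))"
    by (auto simp: smooth_sections_plane_circle)
  have t0: "snd (t p) \<noteq> 0" if "p \<in> U" for p using t[OF that] by auto
  note dt = smooth_on_has_derivative[OF st]
  show "Re (connection (plane_spinc A) (U, t) p X) = 0" if "p \<in> U" for p X
    using im Re_log_derivative_unit[OF U that _ dt[OF that]] t by simp
  show "connection (plane_spinc A) (U, t) p (tlin a X b Y) =
      of_real a * connection (plane_spinc A) (U, t) p X + of_real b * connection (plane_spinc A) (U, t) p Y"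
    if "p \<in> U" for p X Y a b
  proof -
    note ld = has_derivative_linear[OF dt[OF that]]
    show ?thesis
      by (simp add: tlin_def linear_add[OF lin] linear_scale[OF lin] linear_add[OF ld] linear_scale[OF ld])
         (simp add: scaleR_conv_of_real algebra_simps)
  qed
  show "smooth_on (snd c ` (U \<inter> fst c)) (\<lambda>x. connection (plane_spinc A) (U, t) (cinv c x)
      (coord_vec (plane_spinc A) c i (cinv c x)))" if "c \<in> charts (plane_spinc A)" for c i
    using that U t0 by (auto simp: coord_vec_def intro!: smooth_on_add smooth_on_mult smooth_on_inverse
        smooth_on_derivative[OF st] st smooth_on_subset[OF smooth])
  show "case z of (V, t') \<Rightarrow> \<forall>h. smooth_map (plane_spinc A) (U \<inter> V) h \<longrightarrow>
        (\<forall>p\<in>U \<inter> V. h p \<in> circle \<and> t' p = act (circle_bundle (plane_spinc A)) (t p) (h p)) \<longrightarrow>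
        (\<forall>p\<in>U \<inter> V. \<forall>X\<in>tangent_space (plane_spinc A) p.
          connection (plane_spinc A) (V, t') p X =
          connection (plane_spinc A) (U, t) p X + inverse (h p) * deriv_along (plane_spinc A) p X h)"
    if "z \<in> ?S" for z
  proof (clarify)
    fix V t' h p X
    assume z: "z = (V, t')" and h: "smooth_map (plane_spinc A) (U \<inter> V) h"
      and th: "\<forall>p\<in>U \<inter> V. h p \<in> circle \<and> t' p = act (circle_bundle (plane_spinc A)) (t p) (h p)"
      and p: "p \<in> U" "p \<in> V"
    have V: "open V" using that z by (auto simp: smooth_sections_plane_circle)
    have dh: "(h has_derivative frechet_derivative h (at p)) (at p)"
      using h p by (auto intro: smooth_on_has_derivative)
    have "((\<lambda>y. snd (t' y)) has_derivative (\<lambda>v. snd (t p) * frechet_derivative h (at p) v +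
        frechet_derivative (\<lambda>y. snd (t y)) (at p) v * h p)) (at p)"
      \<comment> \<open>The factorisation of \<open>t'\<close> holds only on the overlap, which is
        open.\<close>
      by (rule has_derivative_cong_open[of "U \<inter> V", OF _ _ _ has_derivative_mult[OF dt[OF p(1)] dh]])
         (use U V p th in auto)
    note e = frechet_derivative_eqI[OF this]
    have "cmod (h p) = 1" "cmod (snd (t p)) = 1" "snd (t' p) = snd (t p) * h p" using p th t by auto
    moreover from this have "h p \<noteq> 0" "snd (t p) \<noteq> 0" by auto
    ultimately show "connection (plane_spinc A) (V, t') p X =
        connection (plane_spinc A) (U, t) p X + inverse (h p) * deriv_along (plane_spinc A) p X h"
      by (simp add: e field_simps)
  qed
qed

lemma riemannian_spinc_plane:
  assumes "\<And>v. smooth_on UNIV (\<lambda>x. A x v)" "\<And>x. linear (A x)" "\<And>x v. Re (A x v) = 0"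
  shows "riemannian_spinc_manifold (plane_spinc A)"
  using assms oriented_riemannian_plane spinc_structure_plane circle_connection_plane
    connectedin_topspace[of "euclidean :: (real ^ 2) topology"]
  by (auto simp: riemannian_spinc_manifold_def)

section \<open>Spinors on the flat plane\<close>

text \<open>Presents a class as the graph of a function of \<open>h\<close>, so that components at a
  bundle point are unique and operations on classes can be checked fibrewise.\<close>

lemma spinor_class_plane:
  "spinor_class (plane_spinc A) (p, mat 1) v =
    {((p, h), matrix_inv h *v v) | h. h \<in> spinc_group gamma2}"
proof -
  have "h *v w = v \<longleftrightarrow> w = matrix_inv h *v v" if h: "h \<in> spinc_group gamma2" for h w
  proof -
    obtain k where k: "k \<in> spinc_group gamma2" "h ** k = mat 1" "k ** h = mat 1"
      using h by (rule spinc_group_gamma2_inverse)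
    then have inv: "matrix_inv h = k" by (intro matrix_inv_eqI)
    have "h *v (k *v v) = v" "k *v (h *v w) = w"
      by (simp_all only: matrix_vector_mul_assoc k matrix_vector_mul_lid)
    then show ?thesis unfolding inv by auto
  qed
  then show ?thesis by (auto simp: spinor_class_def)
qed

lemma matrix_inv_mat_1 [simp]: "matrix_inv (mat 1 :: 'a::semiring_1 ^ 'n::finite ^ 'n) = mat 1"
  by (rule matrix_inv_eqI) simp_all

lemma mem_spinor_class_plane:
  "((p, mat 1), w) \<in> spinor_class (plane_spinc A) (p, mat 1) v \<longleftrightarrow> w = v"
  by (auto simp: spinor_class_plane intro!: exI[of _ "mat 1"])

lemma spinor_comp_plane [simp]:
  "spinor_comp (spinor_class (plane_spinc A) (p, mat 1) v) (p, mat 1) = v"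
  by (simp add: spinor_comp_def mem_spinor_class_plane)

lemma spinor_class_plane_neq_zero:
  assumes "v \<noteq> 0"
  shows "spinor_class (plane_spinc A) (p, mat 1) v \<noteq> zero_spinor (plane_spinc A) p"
proof
  assume "spinor_class (plane_spinc A) (p, mat 1) v = zero_spinor (plane_spinc A) p"
  then have "((p, mat 1), v) \<in> zero_spinor (plane_spinc A) p" by (metis mem_spinor_class_plane)
  then show False using assms by (simp add: zero_spinor_def)
qed

lemma spinor_scale_plane:
  "spinor_scale z (spinor_class (plane_spinc A) (p, mat 1) v) =
    spinor_class (plane_spinc A) (p, mat 1) (z *s v)"
  by (auto simp: spinor_scale_def spinor_class_plane vector_scalar_commute)

text \<open>Equivariance of Clifford multiplication: passing to the frame under \<open>h\<close>
  applies the inverse rotation to the components of \<open>x\<close>, which is conjugation by the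
  inverse of \<open>h\<close>. This makes \<open>cliff_mult\<close> respect classes.\<close>

lemma cliff_gamma2_rot_frame:
  assumes "h \<in> spinc_group gamma2"
  shows "cliff gamma2 (\<chi> i. x \<bullet> column i (spinc_Ad gamma2 h)) ** matrix_inv h =
    matrix_inv h ** cliff gamma2 x"
proof -
  obtain a d where h: "h = mat2 a 0 0 d" "cmod a = 1" "cmod d = 1"
    using assms by (rule spinc_group_gamma2E)
  have "cplx (\<chi> i. x \<bullet> column i (spinc_Ad gamma2 h)) = cnj (a * cnj d) * cplx x"
    unfolding h(1) spinc_Ad_gamma2[OF h(2,3)]
    by (simp add: cplx_def rot2_def inner_vec_def sum_2 column_def complex_eq_iff algebra_simps)
  then show ?thesis
    using unit_mult_cnj[OF h(2)] unit_mult_cnj[OF h(3)]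
    by (simp add: h cliff_gamma2 matrix_inv_diag mat2_mult)
qed

lemma cliff_mult_plane:
  "cliff_mult (plane_spinc A) X (spinor_class (plane_spinc A) (p, mat 1) v) =
    spinor_class (plane_spinc A) (p, mat 1) (cliff gamma2 (X std_chart) *v v)"
proof -
  have "cliff gamma2 (\<chi> i. X std_chart \<bullet> column i (spinc_Ad gamma2 h)) *v (matrix_inv h *v v) =
      matrix_inv h *v (cliff gamma2 (X std_chart) *v v)" if "h \<in> spinc_group gamma2" for h
    using cliff_gamma2_rot_frame[OF that] by (simp add: matrix_vector_mul_assoc)
  then show ?thesis
    by (auto simp: cliff_mult_def spinor_class_plane)
qed

text \<open>The definite description ranges over all representatives; they agree because the
  structure group acts unitarily.\<close>

lemma hprod_plane:
  "hprod (spinor_class (plane_spinc A) (p, mat 1) v) (spinor_class (plane_spinc A) (p, mat 1) w) =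
    v $ 1 * cnj (w $ 1) + v $ 2 * cnj (w $ 2)"
proof -
  have unitary: "(matrix_inv h *v v) $ 1 * cnj ((matrix_inv h *v w) $ 1) +
      (matrix_inv h *v v) $ 2 * cnj ((matrix_inv h *v w) $ 2) =
      v $ 1 * cnj (w $ 1) + v $ 2 * cnj (w $ 2)" if "h \<in> spinc_group gamma2" for h
  proof -
    obtain a d where h: "h = mat2 a 0 0 d" "cmod a = 1" "cmod d = 1"
      using \<open>h \<in> _\<close> by (rule spinc_group_gamma2E)
    have "(matrix_inv h *v v) $ 1 * cnj ((matrix_inv h *v w) $ 1) +
        (matrix_inv h *v v) $ 2 * cnj ((matrix_inv h *v w) $ 2) =
        (a * cnj a) * (v $ 1 * cnj (w $ 1)) + (d * cnj d) * (v $ 2 * cnj (w $ 2))"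
      by (simp add: h matrix_inv_diag mat2_mult_vec_nth mult_ac)
    then show ?thesis by (simp only: unit_mult_cnj h(2,3) mult_1)
  qed
  show ?thesis
    unfolding hprod_def
  proof (rule the_equality)
    show "\<exists>q v' w'. (q, v') \<in> spinor_class (plane_spinc A) (p, mat 1) v \<and>
        (q, w') \<in> spinor_class (plane_spinc A) (p, mat 1) w \<and>
        v $ 1 * cnj (w $ 1) + v $ 2 * cnj (w $ 2) = (\<Sum>k\<in>UNIV. v' $ k * cnj (w' $ k))"
      by (intro exI[of _ "(p, mat 1)"] exI[of _ v] exI[of _ w]) (simp add: mem_spinor_class_plane sum_2)
  qed (auto simp: spinor_class_plane sum_2 unitary)
qed

text \<open>Over the global section the frame and the circle section are constant: the Levi-Civita
  term and the logarithmic derivative vanish, and only \<open>A\<close> survives.\<close>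

lemma spinc_deriv_plane:
  fixes \<phi> :: "real ^ 2 \<Rightarrow> complex ^ 2"
  shows "spinc_deriv (plane_spinc A) X (\<lambda>p. spinor_class (plane_spinc A) (p, mat 1) (\<phi> p)) p =
    spinor_class (plane_spinc A) (p, mat 1)
      (frechet_derivative \<phi> (at p) (X std_chart) + (A p (X std_chart) / 2) *s \<phi> p)"
proof -
  have "(SOME (U, s). (U, s) \<in> trivs (spinc_bundle (plane_spinc A)) \<and> p \<in> U) =
      (UNIV, \<lambda>p. (p, mat 1))"
    by (rule some_equality) auto
  moreover have "(\<chi> k. 0) = (0 :: real ^ 2)" by (simp add: vec_eq_iff)
  ultimately show ?thesis
    by (simp add: spinc_deriv_def levi_civita_plane)
qed

lemma q_fun_plane:
  assumes "\<psi> p = spinor_class (plane_spinc A) (p, mat 1) v"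
  shows "q_fun (plane_spinc A) \<psi> p = ((cmod (v $ 1))\<^sup>2 - (cmod (v $ 2))\<^sup>2)\<^sup>2"
proof -
  define m where "m = v $ 2 * cnj (v $ 1)"
  \<comment> \<open>With z = \<open>cplx x\<close>, i times the Hermitian product is i (z m - cnj (z
    m)) = -2 Im (z m), and \<open>V\<close> collects the coefficients of \<open>x\<close>. Its
    squared norm 4 |u|^2 |s|^2 completes the square.\<close>
  define V :: "real ^ 2" where "V = vector [- 2 * Im m, - 2 * Re m]"
  have V: "complex_of_real (V \<bullet> x) =
      \<i> * hprod (cliff_mult (plane_spinc A) (const_tvec x) (\<psi> p)) (\<psi> p)" for x
    by (simp add: assms cliff_mult_plane hprod_plane cliff_gamma2 mat2_mult_vec_nth inner_vec_def sum_2
        V_def m_def cplx_def complex_eq_iff algebra_simps)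
  have "dirac_current (plane_spinc A) \<psi> p = const_tvec V"
    unfolding dirac_current_def
  proof (rule the_equality)
    fix Y assume "Y \<in> tangent_space (plane_spinc A) p \<and> (\<forall>X\<in>tangent_space (plane_spinc A) p.
      complex_of_real (metric (plane_spinc A) p Y X) = \<i> * hprod (cliff_mult (plane_spinc A) X (\<psi> p)) (\<psi> p))"
    then obtain y where y: "Y = const_tvec y" "\<And>x. complex_of_real (y \<bullet> x) = complex_of_real (V \<bullet> x)"
      by (auto simp: V)
    then have "y = V" by (metis of_real_eq_iff vector_eq_rdot)
    with y show "Y = const_tvec V" by simp
  qed (auto simp: V)
  moreover have "V \<bullet> V = 4 * (cmod m)\<^sup>2"
    by (simp add: V_def inner_vec_def sum_2 cmod_power2) (simp add: power2_eq_square)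
  moreover have "cmod m = cmod (v $ 2) * cmod (v $ 1)" by (simp add: m_def norm_mult)
  moreover have "spinor_norm_sq \<psi> p = (cmod (v $ 1))\<^sup>2 + (cmod (v $ 2))\<^sup>2"
    by (simp add: spinor_norm_sq_def assms hprod_plane cmod_power2) (simp add: power2_eq_square)
  ultimately show ?thesis
    by (simp add: q_fun_def power2_eq_square algebra_simps)
qed

lemma killing_spinor_plane:
  fixes \<phi> :: "real ^ 2 \<Rightarrow> complex ^ 2"
  assumes "smooth_on UNIV b" "smooth_on UNIV \<phi>" "\<phi> p \<noteq> 0"
    and "\<And>x v. frechet_derivative \<phi> (at x) v + (A x v / 2) *s \<phi> x =
      (\<i> * complex_of_real (b x)) *s (cliff gamma2 v *v \<phi> x)"
  shows "imaginary_generalized_killing_spinor (plane_spinc A) b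
    (\<lambda>p. spinor_class (plane_spinc A) (p, mat 1) (\<phi> p))"
proof -
  have "spinor_class (plane_spinc A) (x, mat 1) (\<phi> x) \<in> spinor_fibre (plane_spinc A) x" for x
    by (force simp: spinor_fibre_def)
  then show ?thesis
    using assms(1,2) spinor_class_plane_neq_zero[OF assms(3), of A p]
    by (auto simp: imaginary_generalized_killing_spinor_def spinor_field_def spinc_deriv_plane
      cliff_mult_plane spinor_scale_plane assms(4))
qed

section \<open>The Killing spinor\<close>

lemma bounded_linear_axis:
  "bounded_linear (axis k :: 'a::euclidean_space \<Rightarrow> 'a ^ 'n::finite)"
  by (intro linear_conv_bounded_linear[THEN iffD1] linearI) (auto simp: vec_eq_iff axis_def)

lemma bounded_linear_cplx: "bounded_linear cplx"
  by (intro linear_conv_bounded_linear[THEN iffD1] linearI) (auto simp: cplx_def complex_eq_iff)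

text \<open>The functions \<open>cosh 2t\<close> and \<open>cosh t\<close> for \<open>sinh 2t = |x|\<close>. The second component of the spinor
  is then \<open>- \<i> (cnj z / |z|) sinh t = - \<i> cnj z / (2 cosh t)\<close>, which is smooth at the origin.\<close>

definition hyp_radius :: "real ^ 2 \<Rightarrow> real" where
  "hyp_radius x = sqrt (1 + x \<bullet> x)"

definition up_comp :: "real ^ 2 \<Rightarrow> real" where
  "up_comp x = sqrt ((1 + hyp_radius x) / 2)"

definition killing_fun :: "real ^ 2 \<Rightarrow> real" where
  "killing_fun x = 1 / (2 * hyp_radius x)"

text \<open>This is A = 2 i b tanh t on the unit angular vector and 0 radially, with b = 1 / (2 cosh
  2t) and tanh t = r / (1 + cosh 2t); the numerator is r squared times the differential of the polar
  angle.\<close>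

definition conn_form :: "real ^ 2 \<Rightarrow> real ^ 2 \<Rightarrow> complex" where
  "conn_form x v = \<i> * of_real ((x $ 1 * v $ 2 - x $ 2 * v $ 1) / (hyp_radius x * (1 + hyp_radius x)))"

definition down_comp :: "real ^ 2 \<Rightarrow> complex" where
  "down_comp x = - \<i> / 2 * (cnj (cplx x) * of_real (inverse (up_comp x)))"

definition killing_comp :: "real ^ 2 \<Rightarrow> complex ^ 2" where
  "killing_comp x = axis 1 (of_real (up_comp x)) + axis 2 (down_comp x)"

lemma killing_comp_nth [simp]:
  "killing_comp x $ 1 = of_real (up_comp x)" "killing_comp x $ 2 = down_comp x"
  by (simp_all add: killing_comp_def axis_def)

lemma hyp_radius_ge: "hyp_radius x \<ge> 1"
  by (simp add: hyp_radius_def)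

lemma hyp_radius_pos [simp]: "hyp_radius x > 0" "hyp_radius x \<noteq> 0"
  using hyp_radius_ge[of x] by linarith+

lemma up_comp_pos [simp]: "up_comp x > 0" "up_comp x \<noteq> 0"
  using hyp_radius_ge[of x] by (simp_all add: up_comp_def)

lemma hyp_radius_eq: "hyp_radius x = 2 * (up_comp x)\<^sup>2 - 1"
  using hyp_radius_ge[of x] by (simp add: up_comp_def field_simps)

text \<open>The identity sinh^2 2t = 4 cosh^2 t (cosh^2 t - 1). It expresses the squared radius as a
  polynomial in \<open>up_comp\<close>.\<close>

lemma inner_eq_up_comp: "x \<bullet> x = 4 * (up_comp x) ^ 4 - 4 * (up_comp x)\<^sup>2"
proof -
  have "x \<bullet> x = (hyp_radius x)\<^sup>2 - 1" by (simp add: hyp_radius_def)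
  then show ?thesis by (simp add: hyp_radius_eq power2_eq_square power4_eq_xxxx algebra_simps)
qed

lemma smooth_hyp_radius: "smooth_on UNIV hyp_radius"
proof -
  have "smooth_on UNIV (\<lambda>x::real ^ 2. sqrt (1 + x \<bullet> x))"
    by (intro smooth_on_sqrt smooth_on_add smooth_on_const smooth_on_bilinear[OF _ bounded_bilinear_inner]
        smooth_on_bounded_linear bounded_linear_ident open_UNIV) (simp add: add_pos_nonneg)
  then show ?thesis by (simp add: hyp_radius_def[abs_def])
qed

lemma smooth_up_comp: "smooth_on UNIV up_comp"
proof -
  have "smooth_on UNIV (\<lambda>x. sqrt ((1 + hyp_radius x) * (1 / 2)))"
    by (intro smooth_on_sqrt smooth_on_mult smooth_on_add smooth_on_const smooth_hyp_radius open_UNIV)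
       (simp add: add_pos_pos)
  then show ?thesis by (simp add: up_comp_def[abs_def])
qed

lemma smooth_killing_fun: "smooth_on UNIV killing_fun"
proof -
  have "smooth_on UNIV (\<lambda>x. inverse (2 * hyp_radius x))"
    by (intro smooth_on_inverse smooth_on_mult smooth_on_const smooth_hyp_radius open_UNIV) simp
  then show ?thesis by (simp add: killing_fun_def[abs_def] inverse_eq_divide)
qed

lemma smooth_conn_form: "smooth_on UNIV (\<lambda>x. conn_form x v)"
proof -
  have nonzero: "hyp_radius x * (1 + hyp_radius x) \<noteq> 0" for x
    using hyp_radius_ge[of x] by simp
  have nth: "smooth_on UNIV (\<lambda>x::real ^ 2. x $ i)" for i
    by (rule smooth_on_bounded_linear[OF open_UNIV bounded_linear_vec_nth])
  \<comment> \<open>Difference and quotient are recast as sum and inverse to fit the closure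
    rules.\<close>
  have "smooth_on UNIV (\<lambda>x. \<i> * of_real ((x $ 1 * v $ 2 + x $ 2 * (- v $ 1)) *
      inverse (hyp_radius x * (1 + hyp_radius x))))"
    by (intro smooth_on_mult smooth_on_add smooth_on_const smooth_on_inverse smooth_hyp_radius open_UNIV
        smooth_on_linear_comp[OF _ bounded_linear_of_real] nth nonzero)
  then show ?thesis by (simp add: conn_form_def divide_inverse)
qed

lemma linear_conn_form: "linear (conn_form x)"
  by (rule linearI) (simp_all add: conn_form_def complex_eq_iff add_divide_distrib diff_divide_distrib algebra_simps)

lemma Re_conn_form: "Re (conn_form x v) = 0"
  by (simp add: conn_form_def)

lemma smooth_killing_comp: "smooth_on UNIV killing_comp"
  unfolding killing_comp_def[abs_def] down_comp_def
  by (intro smooth_on_add smooth_on_linear_comp[OF _ bounded_linear_axis] smooth_on_mult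
      smooth_on_linear_comp[OF _ bounded_linear_of_real] smooth_on_inverse smooth_up_comp
      smooth_on_linear_comp[OF _ bounded_linear_cnj] smooth_on_bounded_linear[OF _ bounded_linear_cplx]
      smooth_on_const open_UNIV) simp

lemma up_comp_has_derivative:
  "(up_comp has_derivative (\<lambda>v. (x \<bullet> v) / (4 * hyp_radius x * up_comp x))) (at x)"
proof -
  have "(hyp_radius has_derivative (\<lambda>v. (x \<bullet> v) / hyp_radius x)) (at x)"
    unfolding hyp_radius_def[abs_def]
    by (rule has_derivative_eq_rhs, rule has_derivative_real_sqrt, simp add: add_pos_nonneg,
        rule has_derivative_add[OF has_derivative_const has_derivative_inner[OF has_derivative_ident has_derivative_ident]])
       (auto simp: fun_eq_iff inner_commute field_simps)
  then have "((\<lambda>x. (1 + hyp_radius x) / 2) has_derivative (\<lambda>v. (x \<bullet> v) / hyp_radius x / 2)) (at x)"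
    by (auto intro!: derivative_eq_intros)
  moreover have "(1 + hyp_radius x) / 2 > 0" using hyp_radius_ge[of x] by simp
  ultimately show ?thesis
    unfolding up_comp_def[abs_def]
    by (intro has_derivative_eq_rhs[OF has_derivative_real_sqrt]) (auto simp: field_simps)
qed

text \<open>The derivative is stated unsimplified, exactly as the differentiation rules assemble it,
  so that these rules unify with it directly.\<close>

lemma killing_comp_has_derivative:
  "(killing_comp has_derivative (\<lambda>v. axis 1 (of_real ((x \<bullet> v) / (4 * hyp_radius x * up_comp x))) +
    axis 2 (- \<i> / 2 * (cnj (cplx x) * of_real (- (inverse (up_comp x) *
        ((x \<bullet> v) / (4 * hyp_radius x * up_comp x)) * inverse (up_comp x))) +
      cnj (cplx v) * of_real (inverse (up_comp x)))))) (at x)"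
  unfolding killing_comp_def[abs_def] down_comp_def
  by (rule has_derivative_add;
      rule bounded_linear.has_derivative[OF bounded_linear_axis])
     (rule bounded_linear.has_derivative[OF bounded_linear_of_real] up_comp_has_derivative
      has_derivative_mult_right has_derivative_mult Deriv.has_derivative_inverse up_comp_pos
      bounded_linear.has_derivative[OF bounded_linear_cnj] bounded_linear_imp_has_derivative[OF bounded_linear_cplx])+

lemma killing_equation:
  "frechet_derivative killing_comp (at x) v + (conn_form x v / 2) *s killing_comp x =
    (\<i> * complex_of_real (killing_fun x)) *s (cliff gamma2 v *v killing_comp x)"
proof -
  define C W where "C = up_comp x" and "W = hyp_radius x"
  \<comment> \<open>Coordinates of the point and of the direction; here \<open>r\<close> is not the
    radius and \<open>s\<close> is not a spinor component.\<close>
  define p q r s where "p = x $ 1" and "q = x $ 2" and "r = v $ 1" and "s = v $ 2"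
  have W: "W = 2 * C\<^sup>2 - 1" "W \<noteq> 0" and C: "C \<noteq> 0" by (simp_all add: C_def W_def hyp_radius_eq[symmetric])
  have e: "p\<^sup>2 + q\<^sup>2 = 4 * C ^ 4 - 4 * C\<^sup>2"
    using inner_eq_up_comp[of x] by (simp add: C_def p_def q_def inner_vec_def sum_2 power2_eq_square)
  have W1: "1 + W = 2 * C\<^sup>2" using W by simp
  show ?thesis
    unfolding frechet_derivative_eqI[OF killing_comp_has_derivative] vec_2_eq_iff
    using W(2) C
    apply (simp add: cliff_gamma2 mat2_mult_vec_nth axis_def conn_form_def killing_fun_def down_comp_def
      cplx_def inner_vec_def sum_2 W1 complex_eq_iff
      flip: C_def W_def p_def q_def r_def s_def)
    apply (intro conjI)
    subgoal by (simp add: field_simps power2_eq_square)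
    subgoal by (simp add: field_simps power2_eq_square)
    \<comment> \<open>The upper component needed only 1 + W = 2 C^2. The lower one also involves the
      squared radius: after clearing denominators it is a polynomial identity modulo
      \<open>e\<close> and \<open>W(1)\<close>.\<close>
    subgoal apply (simp add: divide_simps) using e W(1) by algebra
    subgoal apply (simp add: divide_simps) using e W(1) by algebra
    done
qed

text \<open>The squared moduli are cosh^2 t and sinh^2 t, the latter as r^2 / (4 cosh^2 t).\<close>

lemma killing_comp_type_II:
  "((cmod (killing_comp x $ 1))\<^sup>2 - (cmod (killing_comp x $ 2))\<^sup>2)\<^sup>2 = 1"
proof -
  have "(cmod (down_comp x))\<^sup>2 = (x \<bullet> x) / (4 * (up_comp x)\<^sup>2)"
    by (simp add: down_comp_def norm_mult norm_divide norm_inverse power_mult_distrib power_divide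
      dot_square_norm abs_of_pos field_simps)
  also have "\<dots> = (up_comp x)\<^sup>2 - 1"
    by (simp add: inner_eq_up_comp field_simps power2_eq_square power4_eq_xxxx)
  finally show ?thesis by simp
qed

theorem theorem4p6:
  shows "\<exists>(M :: (real ^ 2, 2, 2, (real ^ 2) \<times> (complex ^ 2 ^ 2), (real ^ 2) \<times> complex) spinc)
           (b :: real ^ 2 \<Rightarrow> real)
           (\<psi> :: real ^ 2 \<Rightarrow> ((real ^ 2) \<times> (complex ^ 2 ^ 2), 2) spinor).
           riemannian_spinc_manifold M \<and>
           imaginary_generalized_killing_spinor M b \<psi> \<and>
           type_II M \<psi> \<and>
           \<not> (b constant_on points M)"
proof -
  let ?M = "plane_spinc conn_form"
  let ?\<psi> = "\<lambda>p. spinor_class ?M (p, mat 1) (killing_comp p)"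
  have "killing_comp 0 \<noteq> 0" by (simp add: vec_2_eq_iff)
  then have "imaginary_generalized_killing_spinor ?M killing_fun ?\<psi>"
    by (rule killing_spinor_plane[OF smooth_killing_fun smooth_killing_comp _ killing_equation])
  moreover have "riemannian_spinc_manifold ?M"
    by (intro riemannian_spinc_plane smooth_conn_form linear_conn_form Re_conn_form)
  moreover have "type_II ?M ?\<psi>"
    unfolding type_II_def
  proof (intro exI[of _ 1] conjI ballI)
    show "q_fun ?M ?\<psi> p = 1" for p
      by (rule trans[OF q_fun_plane[of ?\<psi> p, OF refl] killing_comp_type_II])
  qed simp
  moreover have "\<not> killing_fun constant_on points ?M"
  proof
    assume "killing_fun constant_on points ?M"
    \<comment> \<open>The two values are 1/2 and 1 / (2 sqrt 2).\<close>
    then have "killing_fun 0 = killing_fun (axis 1 1)" by (auto simp: constant_on_def)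
    then show False by (simp add: killing_fun_def hyp_radius_def inner_axis_axis)
  qed
  ultimately show ?thesis by blast
qed

end
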